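(* Let $P\subset\mathbb R^2$ be a euclidean polygon, and for $z\in P$ let $h_z(l)$ be the position complexity of the billiard flow in $P$. Then for any $\varepsilon>0$ and (Lebesgue) almost every $z\in P$ we have $h_z(l)=O(l^{2+\varepsilon})$ as $l\to\infty$.
   Context: A polygon $P$ is a compact connected region bounded by finitely many straight sides, not necessarily simply connected. The billiard flow moves a point with unit speed along straight lines in $P$, reflecting at the sides by the law of geometric optics; an orbit is regular if it does not hit a corner of $P$. For $z\in P$ let $R_z$ be the set of unit vectors at $z$ (directed into $P$) and let $O_z(l)$ be the set of regular billiard orbits of length $l$ starting from $R_z$. Two orbits in $O_z(l)$ are homotopic if they can be joined by a continuous family of orbits in $O_z(l)$. The position complexity $h_z(l)$ is the number of homotopy classes in $O_z(l)$, i.e. the number of connected components of the set of initial directions at $z$ whose billiard orbit hits no corner up to time $l$. *)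

theory Defs
  imports "HOL-Analysis.Analysis" "HOL-Library.Landau_Symbols"
begin

definition polygon :: "(real^2) set \<Rightarrow> bool" where
  "polygon P \<longleftrightarrow>
     P \<noteq> {} \<and> compact P \<and> connected P \<and> closure (interior P) = P \<and>
     (\<exists>S. finite S \<and> frontier P = (\<Union>(a, b)\<in>S. closed_segment a b))"

text \<open>
  Near a point in the relative interior of a side, \<open>P\<close> is a half-disc; the vector \<open>n\<close> below
  is then the inward unit normal, and it is unique. The corners are the remaining boundary points,
  so boundary points of angle \<open>\<pi>\<close> are not corners, and points at which \<open>P\<close> is pinched are.
\<close>

definition side_point :: "(real^2) set \<Rightarrow> real^2 \<Rightarrow> real^2 \<Rightarrow> bool" where
  "side_point P x n \<longleftrightarrow>
     x \<in> frontier P \<and> norm n = 1 \<and>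
     (\<exists>r>0. P \<inter> ball x r = {y \<in> ball x r. (y - x) \<bullet> n \<ge> 0})"

definition corners :: "(real^2) set \<Rightarrow> (real^2) set" where
  "corners P = {x \<in> frontier P. \<nexists>n. side_point P x n}"

text \<open>
  \<open>billiard_flow P x v t y w\<close>: the orbit of \<open>(x, v)\<close> is at \<open>y\<close> with velocity \<open>w\<close> at time \<open>t\<close>.
  It is a relation because at an impact both the incoming and the outgoing velocity occur.
  What it does after a corner has been hit is irrelevant, as such orbits are not regular.
\<close>

inductive billiard_flow ::
  "(real^2) set \<Rightarrow> real^2 \<Rightarrow> real^2 \<Rightarrow> real \<Rightarrow> real^2 \<Rightarrow> real^2 \<Rightarrow> bool"
  for P x v where
  start: "billiard_flow P x v 0 x v"
| move: "billiard_flow P x v t y w \<Longrightarrow> s > 0 \<Longrightarrow>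
     (\<forall>r. 0 < r \<and> r < s \<longrightarrow> y + r *\<^sub>R w \<in> interior P) \<Longrightarrow>
     billiard_flow P x v (t + s) (y + s *\<^sub>R w) w"
| reflect: "billiard_flow P x v t y w \<Longrightarrow> side_point P y n \<Longrightarrow> w \<bullet> n < 0 \<Longrightarrow>
     billiard_flow P x v t y (w - (2 * (w \<bullet> n)) *\<^sub>R n)"

definition inward_directions :: "(real^2) set \<Rightarrow> real^2 \<Rightarrow> (real^2) set" where
  "inward_directions P z =
     {v. norm v = 1 \<and> (\<exists>d>0. \<forall>r. 0 < r \<and> r < d \<longrightarrow> z + r *\<^sub>R v \<in> interior P)}"

text \<open>
  An orbit is identified with its initial direction. Time \<open>0\<close> is not counted as hitting a corner,
  which only concerns the case that \<open>z\<close> itself is a corner.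
\<close>

definition regular_directions :: "(real^2) set \<Rightarrow> real^2 \<Rightarrow> real \<Rightarrow> (real^2) set" where
  "regular_directions P z l =
     {v \<in> inward_directions P z.
        \<not> (\<exists>t y w. 0 < t \<and> t \<le> l \<and> billiard_flow P z v t y w \<and> y \<in> corners P)}"

text \<open>
  Homotopy classes of regular orbits correspond to connected components of the set of their
  initial directions. Since \<^const>\<open>card\<close> vanishes on infinite sets, statements about this
  number have to be accompanied by the finiteness of the set of components.
\<close>

definition position_complexity :: "(real^2) set \<Rightarrow> real^2 \<Rightarrow> real \<Rightarrow> nat" where
  "position_complexity P z l = card (components (regular_directions P z l))"

end

theory Submission
  imports Defs
begin

text \<open>
  For \<open>z\<close> in the interior of \<open>P\<close>, the regular directions are the unit circle minus the directions
  whose orbit hits a corner before time \<open>l\<close>, so \<open>h_z(l)\<close> exceeds the number of the latter by at most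
  one. Unfolding an orbit that hits a corner \<open>A\<close> after the sequence \<open>\<sigma>\<close> of reflections turns it into
  a straight segment from \<open>z\<close> to the preimage of \<open>A\<close> under an isometry \<open>G_\<sigma>\<close>; hence \<open>A\<close>, \<open>\<sigma>\<close>
  and \<open>z\<close> determine the direction. Let \<open>D_\<sigma>\<close> be the set of the points \<open>z\<close> that see \<open>A\<close> in this way
  within time \<open>l\<close>. Billiard orbits being reversible, the images \<open>G_\<sigma>(D_\<sigma>)\<close> are pairwise disjoint,
  and they lie in the disc of radius \<open>l\<close> around \<open>A\<close>. So the number of corner hits has integral
  \<open>O(l^2)\<close> over \<open>P\<close>, and almost everywhere it is \<open>O(l^(2+\<epsilon>))\<close> by Markov's inequality and the
  Borel-Cantelli lemma along \<open>l = 2^k\<close>.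
\<close>

section \<open>Almost everywhere bounds along powers of two\<close>

lemma dyadic_powr_quotient:
  fixes p q :: real
  shows "1 / (2 ^ k) powr p * (2 ^ k) powr q = (2 powr (q - p)) ^ k"
proof -
  have "1 / (2 ^ k) powr p * (2 ^ k) powr q = (2 ^ k :: real) powr (q - p)" by (simp add: powr_diff)
  also have "\<dots> = (2 powr real k) powr (q - p)" by (simp add: powr_realpow)
  also have "\<dots> = (2 powr (q - p)) powr real k" by (rule powr_powr_swap)
  also have "\<dots> = (2 powr (q - p)) ^ k" by (rule powr_realpow) simp
  finally show ?thesis .
qed

text \<open>Markov's inequality at the level \<open>(2 ^ k) powr p\<close>, with the function
  rescaled to the level 1; the bound decays geometrically in \<open>k\<close> once
  \<open>q < p\<close>.\<close>

lemma emeasure_dyadic_level_set: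
  assumes "g \<in> borel_measurable M" "C \<ge> 0"
    and "(\<integral>\<^sup>+x. g x \<partial>M) \<le> ennreal (C * (2 ^ k) powr q)"
  shows "emeasure M {x \<in> space M. 1 \<le> ennreal (1 / (2 ^ k) powr p) * g x} \<le> ennreal (C * (2 powr (q - p)) ^ k)"
proof -
  let ?c = "1 / (2 ^ k) powr p :: real"
  have "emeasure M {x \<in> space M. 1 \<le> ennreal ?c * g x} \<le> ennreal ?c * (\<integral>\<^sup>+x. g x * indicator (space M) x \<partial>M)"
    using assms(1) by (intro nn_integral_Markov_inequality) auto
  also have "(\<integral>\<^sup>+x. g x * indicator (space M) x \<partial>M) = (\<integral>\<^sup>+x. g x \<partial>M)"
    by (rule nn_integral_cong) simp
  also have "ennreal ?c * \<dots> \<le> ennreal ?c * ennreal (C * (2 ^ k) powr q)"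
    using assms(3) by (rule mult_left_mono) simp
  also have "\<dots> = ennreal (?c * (C * (2 ^ k) powr q))"
    using assms(2) by (intro ennreal_mult[symmetric]) simp_all
  also have "?c * (C * (2 ^ k) powr q) = C * (?c * (2 ^ k) powr q)"
    by (rule mult.left_commute)
  finally show ?thesis unfolding dyadic_powr_quotient .
qed

text \<open>The finitely many exceptional terms are finite, so their sum can go into the constant;
  \<open>a k \<ge> 1\<close> makes this additive correction a multiplicative one.\<close>

lemma le_of_eventually_le:
  fixes u :: "nat \<Rightarrow> ennreal" and a :: "nat \<Rightarrow> real"
  assumes "eventually (\<lambda>k. u k \<le> ennreal (a k)) sequentially" "\<And>k. u k \<noteq> \<infinity>" "\<And>k. a k \<ge> 1"
  shows "\<exists>K\<ge>0. \<forall>k. u k \<le> ennreal (K * a k)"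
proof -
  obtain N where N: "\<And>k. k \<ge> N \<Longrightarrow> u k \<le> ennreal (a k)"
    using assms(1) by (auto simp: eventually_sequentially)
  define K where "K = 1 + (\<Sum>k<N. enn2real (u k))"
  have K: "K \<ge> 1" by (simp add: K_def sum_nonneg)
  have "u k \<le> ennreal (K * a k)" for k
  proof (cases "k \<ge> N")
    case True
    have "1 * a k \<le> K * a k" using K assms(3)[of k] by (intro mult_right_mono) simp_all
    then show ?thesis using N[OF True] by (auto intro: order_trans ennreal_leI)
  next
    case False
    then have "enn2real (u k) \<le> (\<Sum>k<N. enn2real (u k))" by (intro member_le_sum) simp_all
    then have "enn2real (u k) * 1 \<le> K * a k"
      using K assms(3)[of k] by (intro mult_mono) (simp_all add: K_def)
    moreover have "u k = ennreal (enn2real (u k))" using assms(2)[of k] by (simp add: less_top)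
    ultimately show ?thesis by (metis ennreal_leI mult.right_neutral)
  qed
  then show ?thesis using K by (intro exI[of _ K]) simp
qed

text \<open>For \<open>q < p\<close> the sets where \<open>f k\<close> reaches
  \<open>(2 ^ k) powr p\<close> have summable measure, so by Borel-Cantelli almost every
  \<open>x\<close> lies in only finitely many of them. These finitely many \<open>k\<close> cost a
  constant factor, since each \<open>f k\<close> has a finite integral and so is finite almost
  everywhere.\<close>

lemma AE_dyadic_bound:
  fixes f :: "nat \<Rightarrow> 'a \<Rightarrow> ennreal"
  assumes f: "\<And>k. f k \<in> borel_measurable M" and p: "q < p" "0 \<le> p" and C: "C \<ge> 0"
    and bound: "\<And>k. (\<integral>\<^sup>+x. f k x \<partial>M) \<le> ennreal (C * (2 ^ k) powr q)"
  shows "AE x in M. \<exists>K\<ge>0. \<forall>k. f k x \<le> ennreal (K * (2 ^ k) powr p)"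
proof -
  define A where "A k = {x \<in> space M. 1 \<le> ennreal (1 / (2 ^ k) powr p) * f k x}" for k
  define \<rho> :: real where "\<rho> = 2 powr (q - p)"
  have \<rho>: "0 < \<rho>" "\<rho> < 1" using p(1) powr_less_mono[of "q - p" 0 2] by (simp_all add: \<rho>_def)
  note [measurable] = f
  have A: "A k \<in> sets M" for k unfolding A_def by measurable
  have emA: "emeasure M (A k) \<le> ennreal (C * \<rho> ^ k)" for k
    unfolding A_def \<rho>_def using f C bound by (rule emeasure_dyadic_level_set)
  then have fin: "emeasure M (A k) < \<infinity>" for k by (rule le_less_trans) simp
  have "measure M (A k) \<le> C * \<rho> ^ k" for k
    using emA[of k] C \<rho> by (simp add: measure_def enn2real_leI)
  moreover have "norm \<rho> < 1" using \<rho> by simp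
  ultimately have "summable (\<lambda>k. measure M (A k))"
    by (intro summable_comparison_test'[OF summable_mult[OF summable_geometric]]) simp_all
  from borel_cantelli_AE1[OF A fin this]
  have "AE x in M. eventually (\<lambda>k. x \<in> space M - A k) sequentially" .
  moreover have "AE x in M. \<forall>k. f k x \<noteq> \<infinity>"
    unfolding AE_all_countable
  proof
    show "AE x in M. f k x \<noteq> \<infinity>" for k
      using f bound[of k] by (intro nn_integral_PInf_AE) (auto simp: top_unique)
  qed
  ultimately show ?thesis
  proof (rule eventually_elim2)
    fix x assume ev: "eventually (\<lambda>k. x \<in> space M - A k) sequentially" and fx: "\<forall>k. f k x \<noteq> \<infinity>"
    have "f k x \<le> ennreal ((2 ^ k) powr p)" if "x \<in> space M - A k" for k
    proof -
      have "f k x = ennreal ((2 ^ k) powr p) * (ennreal (1 / (2 ^ k) powr p) * f k x)"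
        by (simp add: mult.assoc[symmetric] ennreal_mult[symmetric])
      also have "\<dots> \<le> ennreal ((2 ^ k) powr p) * 1"
        using that by (intro mult_left_mono) (auto simp: A_def not_le)
      finally show ?thesis by simp
    qed
    then have "eventually (\<lambda>k. f k x \<le> ennreal ((2 ^ k) powr p)) sequentially"
      using ev by (rule eventually_mono[rotated])
    then show "\<exists>K\<ge>0. \<forall>k. f k x \<le> ennreal (K * (2 ^ k) powr p)"
      using fx p(2) by (intro le_of_eventually_le) (simp_all add: ge_one_powr_ge_zero)
  qed
qed

section \<open>Side points and reflections\<close>

lemma side_point_ball:
  assumes "side_point P x n"
  obtains r where "r > 0" "\<And>y. y \<in> ball x r \<Longrightarrow> y \<in> P \<longleftrightarrow> (y - x) \<bullet> n \<ge> 0"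
    "\<And>y. y \<in> ball x r \<Longrightarrow> y \<in> interior P \<longleftrightarrow> (y - x) \<bullet> n > 0"
proof -
  obtain r where r: "r > 0" and n: "norm n = 1"
    and P: "P \<inter> ball x r = {y \<in> ball x r. (y - x) \<bullet> n \<ge> 0}"
    using assms unfolding side_point_def by blast
  have "{y. (y - x) \<bullet> n \<ge> 0} = {y. n \<bullet> y \<ge> n \<bullet> x}" "{y. (y - x) \<bullet> n > 0} = {y. n \<bullet> y > n \<bullet> x}"
    by (auto simp: inner_diff_left inner_commute[of n])
  moreover have "n \<noteq> 0" using n by auto
  ultimately have half: "interior {y. (y - x) \<bullet> n \<ge> 0} = {y. (y - x) \<bullet> n > 0}"
    by simp
  have "interior P \<inter> ball x r = interior (P \<inter> ball x r)"
    by (simp add: interior_open)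
  also have "P \<inter> ball x r = ball x r \<inter> {y. (y - x) \<bullet> n \<ge> 0}"
    using P by blast
  also have "interior \<dots> = ball x r \<inter> interior {y. (y - x) \<bullet> n \<ge> 0}"
    by (simp add: interior_open)
  also have "\<dots> = ball x r \<inter> {y. (y - x) \<bullet> n > 0}"
    by (simp add: half)
  finally have "\<And>y. y \<in> ball x r \<Longrightarrow> y \<in> interior P \<longleftrightarrow> (y - x) \<bullet> n > 0" by blast
  moreover have "\<And>y. y \<in> ball x r \<Longrightarrow> y \<in> P \<longleftrightarrow> (y - x) \<bullet> n \<ge> 0" using P by blast
  ultimately show thesis using that r by blast
qed

lemma side_point_norm: "side_point P x n \<Longrightarrow> norm n = 1"
  by (simp add: side_point_def)

lemma side_point_notin_interior: "side_point P x n \<Longrightarrow> x \<notin> interior P"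
  by (simp add: side_point_def frontier_def)

text \<open>A smaller ball around a nearby point of the boundary line sees the same half-plane. Side
  points thus form a relatively open part of their line, which serves both finiteness of the side
  lines and measurability.\<close>

lemma side_point_near:
  assumes "side_point P x n"
  obtains r where "r > 0" "\<And>y. y \<in> ball x r \<Longrightarrow> (y - x) \<bullet> n = 0 \<Longrightarrow> side_point P y n"
proof -
  obtain r where r: "r > 0" "\<And>y. y \<in> ball x r \<Longrightarrow> y \<in> P \<longleftrightarrow> (y - x) \<bullet> n \<ge> 0"
    "\<And>y. y \<in> ball x r \<Longrightarrow> y \<in> interior P \<longleftrightarrow> (y - x) \<bullet> n > 0"
    using side_point_ball[OF assms] by metis
  have "side_point P y n" if y: "y \<in> ball x r" "(y - x) \<bullet> n = 0" for y
  proof -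
    obtain d where d: "d > 0" "ball y d \<subseteq> ball x r"
      using y(1) by (meson open_ball open_contains_ball)
    have eq: "(u - x) \<bullet> n = (u - y) \<bullet> n" for u
      using y(2) by (simp add: inner_diff_left)
    have "P \<inter> ball y d = {u \<in> ball y d. (u - y) \<bullet> n \<ge> 0}"
      using r(2) d eq by (auto simp: subset_iff)
    moreover have "y \<in> frontier P"
      using r y unfolding frontier_def by (auto intro: closure_subset[THEN subsetD])
    ultimately show ?thesis
      using d(1) side_point_norm[OF assms] unfolding side_point_def by blast
  qed
  then show thesis using that r(1) by blast
qed

text \<open>Up to scale both normals describe the same half-plane near 0. The vector
  \<open>a *\<^sub>R n - m\<close> is orthogonal to \<open>n\<close> and has inner product
  \<open>a * a - 1\<close> with \<open>m\<close>, which forces \<open>a\<^sup>2 = 1\<close>; testing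
  \<open>n\<close> itself fixes the sign.\<close>

lemma side_point_unique:
  assumes "side_point P x n" "side_point P x m"
  shows "n = m"
proof -
  obtain r where r: "r > 0" "\<And>y. y \<in> ball x r \<Longrightarrow> y \<in> P \<longleftrightarrow> (y - x) \<bullet> n \<ge> 0"
    using side_point_ball[OF assms(1)] by metis
  obtain s where s: "s > 0" "\<And>y. y \<in> ball x s \<Longrightarrow> y \<in> P \<longleftrightarrow> (y - x) \<bullet> m \<ge> 0"
    using side_point_ball[OF assms(2)] by metis
  have nm: "norm n = 1" "norm m = 1" "n \<bullet> n = 1" "m \<bullet> m = 1"
    using assms by (simp_all add: side_point_norm flip: power2_norm_eq_inner)
  define a where "a = n \<bullet> m"
  \<comment> \<open>The test vectors have norm at most 3 and fit into both balls after scaling by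
    \<open>d\<close>.\<close>
  define d where "d = min r s / 4"
  have d: "d > 0" "3 * d < r" "3 * d < s" using r(1) s(1) by (auto simp: d_def)
  have key: "u \<bullet> n \<ge> 0 \<longleftrightarrow> u \<bullet> m \<ge> 0" if "norm u \<le> 3" for u
  proof -
    have "d * norm u \<le> 3 * d" using that d(1) by (simp add: mult.commute)
    then have "d * norm u < r" "d * norm u < s" using d by linarith+
    then have "x + d *\<^sub>R u \<in> ball x r" "x + d *\<^sub>R u \<in> ball x s"
      using d(1) by (simp_all add: dist_norm)
    then have "0 \<le> d * (u \<bullet> n) \<longleftrightarrow> 0 \<le> d * (u \<bullet> m)"
      using r(2)[of "x + d *\<^sub>R u"] s(2)[of "x + d *\<^sub>R u"] by simp
    then show ?thesis using d(1) by (simp add: zero_le_mult_iff)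
  qed
  have "\<bar>a\<bar> \<le> 1" using Cauchy_Schwarz_ineq2[of n m] nm by (simp add: a_def)
  then have "norm (a *\<^sub>R n - m) \<le> 3"
    using nm norm_triangle_ineq4[of "a *\<^sub>R n" m] by simp
  from key[OF this] have "a * a - 1 \<ge> 0"
    using nm by (simp add: inner_diff_left a_def inner_commute[of m n])
  then have "a\<^sup>2 = 1" using abs_le_square_iff[of a 1] \<open>\<bar>a\<bar> \<le> 1\<close> by (simp add: power2_eq_square)
  moreover have "a \<ge> 0" using key[of n] nm by (simp add: a_def inner_commute)
  ultimately have "a = 1" by (simp add: power2_eq_1_iff)
  then have "(n - m) \<bullet> (n - m) = 0"
    using nm by (simp add: a_def inner_diff_left inner_diff_right inner_commute)
  then show ?thesis by simp
qed

section \<open>Folding isometries of the plane\<close>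

text \<open>A line \<open>{y. y \<bullet> n = c}\<close> is encoded as \<open>(n, c)\<close>.\<close>

definition mirror :: "(real^2) \<times> real \<Rightarrow> real^2 \<Rightarrow> real^2" where
  "mirror h y = y - (2 * (y \<bullet> fst h - snd h)) *\<^sub>R fst h"

text \<open>The isometry \<open>G_\<sigma>\<close>, from the unfolded plane to the actual position.
  The mirrors are the actual side lines, not their unfolded images, so the latest reflection, the
  head of the list, is applied last.\<close>

primrec fold_map :: "((real^2) \<times> real) list \<Rightarrow> real^2 \<Rightarrow> real^2" where
  "fold_map [] y = y"
| "fold_map (h # \<sigma>) y = mirror h (fold_map \<sigma> y)"

primrec fold_dir :: "((real^2) \<times> real) list \<Rightarrow> real^2 \<Rightarrow> real^2" where
  "fold_dir [] v = v"
| "fold_dir (h # \<sigma>) v = fold_dir \<sigma> v - (2 * (fold_dir \<sigma> v \<bullet> fst h)) *\<^sub>R fst h"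

lemma linear_fold_dir: "linear (fold_dir \<sigma>)"
proof (induction \<sigma>)
  case Nil
  show ?case by (rule linearI) auto
next
  case (Cons h \<sigma>)
  then show ?case
    by (intro linearI) (simp_all add: linear_add linear_scale inner_add_left algebra_simps)
qed

lemma fold_map_add: "fold_map \<sigma> (x + v) = fold_map \<sigma> x + fold_dir \<sigma> v"
  by (induction \<sigma>) (auto simp: mirror_def inner_add_left algebra_simps)

lemma fold_map_add_scaleR: "fold_map \<sigma> (x + r *\<^sub>R v) = fold_map \<sigma> x + r *\<^sub>R fold_dir \<sigma> v"
  by (simp add: fold_map_add linear_scale[OF linear_fold_dir])

lemma fold_map_eq: "fold_map \<sigma> = (\<lambda>x. fold_map \<sigma> 0 + fold_dir \<sigma> x)"
proof
  show "fold_map \<sigma> x = fold_map \<sigma> 0 + fold_dir \<sigma> x" for x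
    using fold_map_add[of \<sigma> 0 x] by (simp only: add_0)
qed

definition unit_normals where "unit_normals \<sigma> \<longleftrightarrow> (\<forall>h\<in>set \<sigma>. norm (fst h) = 1)"

lemma mirror_mirror: "norm (fst h) = 1 \<Longrightarrow> mirror h (mirror h y) = y"
  by (simp add: mirror_def inner_diff_left algebra_simps flip: power2_norm_eq_inner)

lemma norm_fold_dir: "unit_normals \<sigma> \<Longrightarrow> norm (fold_dir \<sigma> v) = norm v"
proof (induction \<sigma>)
  case (Cons h \<sigma>)
  then have 1: "fst h \<bullet> fst h = 1" "norm (fold_dir \<sigma> v) = norm v"
    by (simp_all add: unit_normals_def flip: power2_norm_eq_inner)
  have "norm (fold_dir (h # \<sigma>) v) = norm (fold_dir \<sigma> v)"
    unfolding norm_eq using 1(1)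
    by (simp add: inner_diff_left inner_diff_right inner_commute[of "fst h" "fold_dir \<sigma> v"])
  then show ?case using 1 by simp
qed simp

lemma orthogonal_fold_dir: "unit_normals \<sigma> \<Longrightarrow> orthogonal_transformation (fold_dir \<sigma>)"
  by (simp add: orthogonal_transformation linear_fold_dir norm_fold_dir)

lemma bij_fold_map:
  assumes "unit_normals \<sigma>" shows "bij (fold_map \<sigma>)"
proof -
  have "bij (fold_dir \<sigma>)" using orthogonal_fold_dir[OF assms] by (rule orthogonal_transformation_bij)
  then have "bij ((+) (fold_map \<sigma> 0) \<circ> fold_dir \<sigma>)" by (rule bij_comp) (rule bij_plus)
  moreover have "fold_map \<sigma> = (+) (fold_map \<sigma> 0) \<circ> fold_dir \<sigma>"
    using fold_map_eq[of \<sigma>] unfolding o_def .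
  ultimately show ?thesis by argo
qed

lemma dist_fold_map: "unit_normals \<sigma> \<Longrightarrow> dist (fold_map \<sigma> x) (fold_map \<sigma> y) = dist x y"
  using fold_map_add[of \<sigma> y "x - y"] norm_fold_dir[of \<sigma> "x - y"] by (simp add: dist_norm)

lemma fold_map_segment:
  "fold_map \<sigma> ((1 - r) *\<^sub>R a + r *\<^sub>R b) = (1 - r) *\<^sub>R fold_map \<sigma> a + r *\<^sub>R fold_map \<sigma> b"
proof -
  have "(1 - r) *\<^sub>R a + r *\<^sub>R b = a + r *\<^sub>R (b - a)" by (simp add: algebra_simps)
  then have "fold_map \<sigma> ((1 - r) *\<^sub>R a + r *\<^sub>R b) = fold_map \<sigma> a + r *\<^sub>R fold_dir \<sigma> (b - a)"
    by (simp only: fold_map_add_scaleR)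
  moreover have "fold_map \<sigma> b = fold_map \<sigma> a + fold_dir \<sigma> (b - a)" using fold_map_add[of \<sigma> a "b - a"] by simp
  ultimately show ?thesis by (simp add: algebra_simps)
qed

lemma fold_map_open_segment:
  assumes "unit_normals \<sigma>"
  shows "fold_map \<sigma> ` open_segment a b = open_segment (fold_map \<sigma> a) (fold_map \<sigma> b)"
proof -
  have "fold_map \<sigma> a = fold_map \<sigma> b \<longleftrightarrow> a = b"
    using bij_is_inj[OF bij_fold_map[OF assms]] by (simp add: inj_eq)
  then show ?thesis
    by (auto simp: open_segment_image_interval fold_map_segment image_image)
qed

text \<open>Points of a segment are ordered along it, and the later one lies between the earlier one
  and \<open>b\<close>. This compares the last impacts of two orbits that end along the same
  segment.\<close>

lemma open_segment_same_end:
  fixes a b u v :: "'a::euclidean_space"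
  assumes "u \<in> open_segment a b" "v \<in> open_segment a b"
  shows "u = v \<or> v \<in> open_segment u b \<or> u \<in> open_segment v b"
proof -
  obtain r where r: "0 < r" "r < 1" "u = (1 - r) *\<^sub>R a + r *\<^sub>R b" "a \<noteq> b"
    using assms(1) by (auto simp: in_segment)
  obtain s where s: "0 < s" "s < 1" "v = (1 - s) *\<^sub>R a + s *\<^sub>R b"
    using assms(2) by (auto simp: in_segment)
  have in_seg: "(1 - s) *\<^sub>R a + s *\<^sub>R b \<in> open_segment ((1 - r) *\<^sub>R a + r *\<^sub>R b) b"
    if "r < s" "s < 1" for r s :: real
  proof -
    \<comment> \<open>The parameter of the second point relative to the subsegment that starts at
      the first.\<close>
    define k where "k = (s - r) / (1 - r)"
    have k: "0 < k" "k < 1" "k * (1 - r) = s - r" using that by (auto simp: k_def)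
    have "(1 - k) *\<^sub>R ((1 - r) *\<^sub>R a + r *\<^sub>R b) + k *\<^sub>R b =
      (1 - r - k * (1 - r)) *\<^sub>R a + (r + k * (1 - r)) *\<^sub>R b"
      by (simp add: algebra_simps)
    also have "\<dots> = (1 - s) *\<^sub>R a + s *\<^sub>R b" unfolding k(3) by simp
    finally have "(1 - s) *\<^sub>R a + s *\<^sub>R b = (1 - k) *\<^sub>R ((1 - r) *\<^sub>R a + r *\<^sub>R b) + k *\<^sub>R b" ..
    moreover have "(1 - r) *\<^sub>R (a - b) \<noteq> 0" using r(4) that by simp
    then have "(1 - r) *\<^sub>R a + r *\<^sub>R b \<noteq> b" by (simp add: algebra_simps)
    ultimately show ?thesis using k by (auto simp: in_segment)
  qed
  show ?thesis
    using in_seg[of r s] in_seg[of s r] r s by (metis linorder_less_linear)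
qed

section \<open>Itineraries of unfolded orbits\<close>

text \<open>
  \<open>itin P \<sigma> z e\<close>: the orbit of length \<open>dist z e\<close> from \<open>z\<close> in the direction of \<open>e\<close> is reflected in
  the sides \<open>\<sigma>\<close> (latest one first) and stays in the interior of \<open>P\<close> in between. The points \<open>e\<close> and
  \<open>q\<close> are unfolded: the orbit ends at \<open>fold_map \<sigma> e\<close>, on which nothing is imposed.
\<close>

primrec itin :: "(real^2) set \<Rightarrow> ((real^2) \<times> real) list \<Rightarrow> real^2 \<Rightarrow> real^2 \<Rightarrow> bool" where
  "itin P [] z e \<longleftrightarrow> z \<in> interior P \<and> open_segment z e \<subseteq> interior P"
| "itin P (h # \<sigma>) z e \<longleftrightarrow> (\<exists>q\<in>open_segment z e. itin P \<sigma> z q \<and>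
     side_point P (fold_map \<sigma> q) (fst h) \<and> fold_map \<sigma> q \<bullet> fst h = snd h \<and>
     fold_map (h # \<sigma>) ` open_segment q e \<subseteq> interior P)"

text \<open>The alphabet of the itineraries. Sides on a common line with the same inward normal
  share one letter.\<close>

definition side_lines where
  "side_lines P = {(n, x \<bullet> n) | x n. side_point P x n}"

lemma itin_side_lines: "itin P \<sigma> z e \<Longrightarrow> \<sigma> \<in> lists (side_lines P)"
proof (induction \<sigma> arbitrary: e)
  case (Cons h \<sigma>)
  then obtain q where "itin P \<sigma> z q" "side_point P (fold_map \<sigma> q) (fst h)" "fold_map \<sigma> q \<bullet> fst h = snd h"
    by auto
  moreover from this have "h \<in> side_lines P"
    unfolding side_lines_def by (metis (mono_tags, lifting) mem_Collect_eq prod.collapse)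
  ultimately show ?case using Cons.IH by auto
qed auto

lemma unit_normals_side_lines: "\<sigma> \<in> lists (side_lines P) \<Longrightarrow> unit_normals \<sigma>"
  by (auto simp: side_lines_def unit_normals_def lists_eq_set side_point_norm)

lemma mirror_fixed: "y \<bullet> fst h = snd h \<Longrightarrow> mirror h y = y"
  by (simp add: mirror_def)

text \<open>Reversibility: the orbit is read backwards from its end. The last impact is a boundary
  point after which the segment stays in the interior, so two candidates coincide; the normal there
  is unique, hence so is the mirror, and removing it leaves a shorter pair of itineraries. This is
  the disjointness of the images \<open>G_\<sigma>(D_\<sigma>)\<close>.\<close>

lemma itin_unique:
  assumes "itin P \<sigma> z e" "itin P \<sigma>' z' e'"
    and "fold_map \<sigma> z = fold_map \<sigma>' z'" "fold_map \<sigma> e = fold_map \<sigma>' e'"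
  shows "\<sigma> = \<sigma>'"
  using assms
proof (induction \<sigma> arbitrary: \<sigma>' e e')
  case Nil
  show ?case
  proof (cases \<sigma>')
    case (Cons h \<tau>)
    \<comment> \<open>The last impact of a nonempty \<open>\<sigma>'\<close> would be a boundary
      point on a segment inside the interior.\<close>
    obtain q where q: "q \<in> open_segment z' e'" "side_point P (fold_map \<tau> q) (fst h)" "fold_map \<tau> q \<bullet> fst h = snd h"
      using Nil.prems(2) Cons by auto
    have "fold_map \<sigma>' q \<in> fold_map \<sigma>' ` open_segment z' e'" using q(1) by blast
    also have "\<dots> = open_segment z e"
      using fold_map_open_segment[OF unit_normals_side_lines[OF itin_side_lines[OF Nil.prems(2)]]]
        Nil.prems(3,4) by simp
    also have "\<dots> \<subseteq> interior P" using Nil.prems(1) by simp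
    finally show ?thesis
      using q(2,3) Cons side_point_notin_interior by (simp add: mirror_fixed)
  qed simp
next
  case (Cons h \<sigma>)
  note un = unit_normals_side_lines[OF itin_side_lines]
  obtain q where q: "q \<in> open_segment z e" "itin P \<sigma> z q" "side_point P (fold_map \<sigma> q) (fst h)"
    "fold_map \<sigma> q \<bullet> fst h = snd h" "fold_map (h # \<sigma>) ` open_segment q e \<subseteq> interior P"
    using Cons.prems(1) by auto
  have uh: "unit_normals (h # \<sigma>)" using un[OF Cons.prems(1)] .
  have fq: "fold_map (h # \<sigma>) q = fold_map \<sigma> q" using q(4) by (simp add: mirror_fixed)
  \<comment> \<open>The orbit unfolded backwards from its end: the final leg is in its true place,
    the earlier ones are reflected into its line. The last mirror fixes the last impact
    point.\<close>
  define a b where "a = fold_map (h # \<sigma>) z" and "b = fold_map (h # \<sigma>) e"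
  have qab: "fold_map \<sigma> q \<in> open_segment a b"
    using q(1) fold_map_open_segment[OF uh, of z e] fq unfolding a_def b_def by (metis imageI)
  have qb: "open_segment (fold_map \<sigma> q) b \<subseteq> interior P"
    using q(5) fold_map_open_segment[OF uh, of q e] fq unfolding b_def by auto
  show ?case
  proof (cases \<sigma>')
    case Nil
    then have "open_segment a b \<subseteq> interior P" using Cons.prems unfolding a_def b_def by auto
    then show ?thesis using qab q(3) side_point_notin_interior by blast
  next
    case (Cons h' \<tau>)
    obtain q' where q': "q' \<in> open_segment z' e'" "itin P \<tau> z' q'" "side_point P (fold_map \<tau> q') (fst h')"
      "fold_map \<tau> q' \<bullet> fst h' = snd h'" "fold_map (h' # \<tau>) ` open_segment q' e' \<subseteq> interior P"
      using Cons.prems(2) Cons by auto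
    have uh': "unit_normals (h' # \<tau>)" using un[OF Cons.prems(2)] Cons by simp
    have fq': "fold_map (h' # \<tau>) q' = fold_map \<tau> q'" using q'(4) by (simp add: mirror_fixed)
    have ab: "a = fold_map (h' # \<tau>) z'" "b = fold_map (h' # \<tau>) e'"
      using Cons.prems(3,4) Cons unfolding a_def b_def by auto
    have qab': "fold_map \<tau> q' \<in> open_segment a b"
      using q'(1) fold_map_open_segment[OF uh', of z' e'] fq' unfolding ab by (metis imageI)
    have qb': "open_segment (fold_map \<tau> q') b \<subseteq> interior P"
      using q'(5) fold_map_open_segment[OF uh', of q' e'] fq' unfolding ab by auto
    \<comment> \<open>If the last impacts differed, one would lie on the final leg of the other,
      which is in the interior.\<close>
    have eq: "fold_map \<sigma> q = fold_map \<tau> q'"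
      using open_segment_same_end[OF qab qab'] qb qb' q(3) q'(3) side_point_notin_interior by blast
    then have "fst h = fst h'" using side_point_unique q(3) q'(3) by metis
    then have hh: "h = h'" using q(4) q'(4) eq by (metis prod.expand)
    \<comment> \<open>The common last mirror is an involution and cancels.\<close>
    have "fold_map \<sigma> z = fold_map \<tau> z'"
      using ab(1) hh uh mirror_mirror unfolding a_def unit_normals_def
      by (metis fold_map.simps(2) list.set_intros(1))
    then show ?thesis using Cons.IH[OF q(2) q'(2) _ eq] hh Cons by simp
  qed
qed

section \<open>Billiard orbits and itineraries\<close>

lemma open_segment_ray:
  fixes z v :: "real^2"
  assumes "v \<noteq> 0" "a < b"
  shows "open_segment (z + a *\<^sub>R v) (z + b *\<^sub>R v) = (\<lambda>r. z + r *\<^sub>R v) ` {a<..<b}"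
proof -
  have eq: "(1 - u) *\<^sub>R (z + a *\<^sub>R v) + u *\<^sub>R (z + b *\<^sub>R v) = z + (a + u * (b - a)) *\<^sub>R v" for u
    by (simp add: algebra_simps)
  have "z + a *\<^sub>R v \<noteq> z + b *\<^sub>R v" using assms by simp
  then have "open_segment (z + a *\<^sub>R v) (z + b *\<^sub>R v) = (\<lambda>u. z + (a + u * (b - a)) *\<^sub>R v) ` {0<..<1}"
    by (simp add: open_segment_image_interval eq)
  also have "\<dots> = (\<lambda>r. z + r *\<^sub>R v) ` ((\<lambda>u. a + u * (b - a)) ` {0<..<1})"
    by (simp add: image_image)
  also have "(\<lambda>u. a + u * (b - a)) ` {0<..<1} = {a<..<b}"
  proof (intro equalityI subsetI)
    fix r assume "r \<in> {a<..<b}"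
    then have "(r - a) / (b - a) \<in> {0<..<1}" "r = a + (r - a) / (b - a) * (b - a)"
      using assms(2) by auto
    then show "r \<in> (\<lambda>u. a + u * (b - a)) ` {0<..<1}" by blast
  next
    fix r assume "r \<in> (\<lambda>u. a + u * (b - a)) ` {0<..<1}"
    then obtain u where u: "0 < u" "u < 1" "r = a + u * (b - a)" by auto
    have "u * (b - a) < 1 * (b - a)" using u assms(2) by (intro mult_strict_right_mono) auto
    then have "u * (b - a) < b - a" by simp
    moreover have "u * (b - a) > 0" using u assms(2) by simp
    ultimately show "r \<in> {a<..<b}" unfolding u(3) greaterThanLessThan_iff by linarith
  qed
  finally show ?thesis .
qed

text \<open>An end point that folds into the interior is no impact: the last leg, the point
  \<open>q\<close> and the added piece form a single longer leg with the same mirrors.\<close>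

lemma itin_extend:
  assumes "itin P \<sigma> z q" "q \<in> open_segment z e"
    and "fold_map \<sigma> ` insert q (open_segment q e) \<subseteq> interior P"
  shows "itin P \<sigma> z e"
proof (cases \<sigma>)
  case Nil
  have "open_segment z e = open_segment z q \<union> {q} \<union> open_segment q e"
    using Un_open_segment[OF assms(2)] by simp
  then show ?thesis using assms Nil by auto
next
  case (Cons h \<tau>)
  then obtain p where p: "p \<in> open_segment z q" "itin P \<tau> z p" "side_point P (fold_map \<tau> p) (fst h)"
    "fold_map \<tau> p \<bullet> fst h = snd h" "fold_map \<sigma> ` open_segment p q \<subseteq> interior P"
    using assms(1) by auto
  have pz: "p \<in> open_segment z e" using p(1) Un_open_segment[OF assms(2)] by blast
  moreover have "q \<in> open_segment p e"
  proof -
    have ez: "e - z \<noteq> 0" using assms(2) by auto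
    obtain a where a: "0 < a" "a < 1" "q = z + a *\<^sub>R (e - z)"
      using assms(2) open_segment_ray[OF ez, of 0 1 z] by auto
    obtain r where r: "r < a" "p = z + r *\<^sub>R (e - z)"
      using p(1) open_segment_ray[OF ez, of 0 a z] a by auto
    show ?thesis using open_segment_ray[OF ez, of r 1 z] a r by auto
  qed
  from Un_open_segment[OF this, symmetric]
  have "fold_map \<sigma> ` open_segment p e \<subseteq> interior P"
    using p(5) assms(3) by auto
  ultimately show ?thesis using p Cons by auto
qed

text \<open>The last leg has positive length, so shortly before its end the orbit is in the
  interior. With \<open>side_point_sign\<close> this gives the sign of the incoming velocity at a
  side.\<close>

lemma itin_tail:
  assumes "itin P \<sigma> z (z + t *\<^sub>R v)" "t > 0" "v \<noteq> 0"
  obtains d where "d > 0"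
    "\<And>r. 0 < r \<Longrightarrow> r < d \<Longrightarrow> fold_map \<sigma> (z + t *\<^sub>R v) - r *\<^sub>R fold_dir \<sigma> v \<in> interior P"
proof -
  note result = that
  have *: thesis if "s < t" "fold_map \<sigma> ` open_segment (z + s *\<^sub>R v) (z + t *\<^sub>R v) \<subseteq> interior P" for s
  proof (rule result[of "t - s"])
    fix r assume r: "0 < r" "r < t - s"
    have "fold_map \<sigma> (z + t *\<^sub>R v) - r *\<^sub>R fold_dir \<sigma> v = fold_map \<sigma> (z + (t - r) *\<^sub>R v)"
      unfolding fold_map_add_scaleR by (simp add: scaleR_diff_left)
    also have "\<dots> \<in> interior P"
      using that(2) r unfolding open_segment_ray[OF assms(3) that(1)] by (auto simp: image_subset_iff)
    finally show "fold_map \<sigma> (z + t *\<^sub>R v) - r *\<^sub>R fold_dir \<sigma> v \<in> interior P" .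
  qed (use that in auto)
  show thesis
  proof (cases \<sigma>)
    case Nil
    then show thesis using *[of 0] assms by auto
  next
    case (Cons h \<tau>)
    then obtain q where q: "q \<in> open_segment z (z + t *\<^sub>R v)" "fold_map \<sigma> ` open_segment q (z + t *\<^sub>R v) \<subseteq> interior P"
      using assms(1) by auto
    then obtain s where "s < t" "q = z + s *\<^sub>R v" using open_segment_ray[OF assms(3,2), of z] by auto
    then show thesis using * q(2) by blast
  qed
qed

text \<open>Near \<open>y\<close> the interior is an open half-disc, so a single short step along
  \<open>w\<close> already shows the sign. Applied to \<open>- w\<close> it treats arrivals.\<close>

lemma side_point_sign:
  assumes "side_point P y n" "0 < d" "\<And>r. 0 < r \<Longrightarrow> r < d \<Longrightarrow> y + r *\<^sub>R w \<in> interior P"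
  shows "w \<bullet> n > 0"
proof -
  obtain e where e: "e > 0" "\<And>u. u \<in> ball y e \<Longrightarrow> u \<in> interior P \<longleftrightarrow> (u - y) \<bullet> n > 0"
    using side_point_ball[OF assms(1)] by metis
  have w: "norm w + 1 > 0" by (simp add: add_nonneg_pos)
  then have "min d (e / (norm w + 1)) > 0" using e(1) assms(2) by simp
  then obtain r where "0 < r" "r < min d (e / (norm w + 1))" using dense by blast
  then have r: "0 < r" "r < d" "r < e / (norm w + 1)" by auto
  have "r * norm w \<le> r * (norm w + 1)" using r(1) by simp
  also have "\<dots> < e" using r(3) w by (simp add: pos_less_divide_eq)
  finally have "y + r *\<^sub>R w \<in> ball y e" using r(1) by (simp add: dist_norm)
  from e(2)[OF this] assms(3)[OF r(1,2)] have "r * (w \<bullet> n) > 0" by simp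
  then show ?thesis using r(1) by (simp add: zero_less_mult_iff)
qed

text \<open>A corner hit expressed by itineraries instead of the flow. It records the first corner
  only, as an itinerary passes through interior and side points before its end.\<close>

definition hits_corner where
  "hits_corner P z v t \<longleftrightarrow> (\<exists>t'>0. t' \<le> t \<and>
    (\<exists>\<sigma>. itin P \<sigma> z (z + t' *\<^sub>R v) \<and> fold_map \<sigma> (z + t' *\<^sub>R v) \<in> corners P))"

lemma hits_corner_mono: "hits_corner P z v t \<Longrightarrow> t \<le> s \<Longrightarrow> hits_corner P z v s"
  unfolding hits_corner_def by (meson order_trans)

text \<open>An invariant of the flow up to its first corner. The alternatives are: no motion yet; an
  arrival at an interior point or at a side still to be reflected in; and the moment after a
  reflection, where the new mirror \<open>h\<close> is recorded but no leg follows it yet, so that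
  only \<open>\<tau>\<close> is an itinerary.\<close>

lemma flow_itin:
  assumes "billiard_flow P z v t y w" "z \<in> interior P" "v \<noteq> 0"
  shows "hits_corner P z v t \<or>
    (\<exists>\<sigma>. y = fold_map \<sigma> (z + t *\<^sub>R v) \<and> w = fold_dir \<sigma> v \<and>
      (t = 0 \<and> \<sigma> = [] \<or>
       t > 0 \<and> itin P \<sigma> z (z + t *\<^sub>R v) \<and> y \<notin> corners P \<or>
       (\<exists>h \<tau>. t > 0 \<and> \<sigma> = h # \<tau> \<and> itin P \<tau> z (z + t *\<^sub>R v) \<and> fold_map \<tau> (z + t *\<^sub>R v) = y \<and>
          side_point P y (fst h) \<and> y \<bullet> fst h = snd h \<and> w \<bullet> fst h > 0)))"
  using assms(1)
proof induction
  case start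
  then show ?case by auto
next
  case (move t y w s)
  show ?case
  proof (cases "hits_corner P z v t")
    case True
    then show ?thesis using hits_corner_mono[of P z v t "t + s"] move.hyps by simp
  next
    case False
    then obtain \<sigma> where \<sigma>: "y = fold_map \<sigma> (z + t *\<^sub>R v)" "w = fold_dir \<sigma> v"
      and cs: "t = 0 \<and> \<sigma> = [] \<or> t > 0 \<and> itin P \<sigma> z (z + t *\<^sub>R v) \<and> y \<notin> corners P \<or>
       (\<exists>h \<tau>. t > 0 \<and> \<sigma> = h # \<tau> \<and> itin P \<tau> z (z + t *\<^sub>R v) \<and> fold_map \<tau> (z + t *\<^sub>R v) = y \<and>
          side_point P y (fst h) \<and> y \<bullet> fst h = snd h \<and> w \<bullet> fst h > 0)"
      using move.IH by blast
    have t0: "t \<ge> 0" using cs by auto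
    have y': "y + r *\<^sub>R w = fold_map \<sigma> (z + (t + r) *\<^sub>R v)" for r
      unfolding \<sigma> by (simp add: scaleR_add_left add.assoc flip: fold_map_add_scaleR)
    have seg: "fold_map \<sigma> ` open_segment (z + t *\<^sub>R v) (z + (t + s) *\<^sub>R v) \<subseteq> interior P"
    proof -
      have "fold_map \<sigma> (z + r *\<^sub>R v) \<in> interior P" if "t < r" "r < t + s" for r
        using move.hyps(3)[rule_format, of "r - t"] y'[of "r - t"] that by simp
      then show ?thesis using open_segment_ray[of v t "t + s" z] assms(3) move.hyps(2) by auto
    qed
    have q: "z + t *\<^sub>R v \<in> open_segment z (z + (t + s) *\<^sub>R v)" if "t > 0"
      using open_segment_ray[of v 0 "t + s" z] that assms(3) move.hyps(2) by auto
    have it: "itin P \<sigma> z (z + (t + s) *\<^sub>R v)"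
      using cs
    proof (elim disjE conjE exE)
      assume "t = 0" "\<sigma> = []"
      then show ?thesis using seg assms(2) by simp
    next
      assume t: "t > 0" and it: "itin P \<sigma> z (z + t *\<^sub>R v)" and nc: "y \<notin> corners P"
      \<comment> \<open>At a side point with normal \<open>n\<close>, leaving along \<open>w\<close>
        gives \<open>w \<bullet> n > 0\<close>, while arriving along the last leg gives
        \<open>w \<bullet> n < 0\<close>. So an orbit that moves on without reflection was not at a
        side.\<close>
      have "y \<in> interior P"
      proof (rule ccontr)
        assume ni: "y \<notin> interior P"
        have "y \<in> closure P"
        proof -
          have lim: "((\<lambda>r. y + r *\<^sub>R w) \<longlongrightarrow> y + 0 *\<^sub>R w) (at_right 0)"
            by (intro tendsto_intros)
          have ev: "eventually (\<lambda>r. y + r *\<^sub>R w \<in> closure P) (at_right 0)"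
            unfolding eventually_at_right_field
            using move.hyps(2,3) interior_subset closure_subset by (intro exI[of _ s]) blast
          have "y + 0 *\<^sub>R w \<in> closure P"
            by (rule Lim_in_closed_set[OF closed_closure ev _ lim]) simp
          then show ?thesis by simp
        qed
        then obtain n where n: "side_point P y n"
          using ni nc by (auto simp: corners_def frontier_def)
        have "w \<bullet> n > 0" using side_point_sign[OF n move.hyps(2)] move.hyps(3) by blast
        moreover obtain d where d: "d > 0" "\<And>r. 0 < r \<Longrightarrow> r < d \<Longrightarrow> y - r *\<^sub>R w \<in> interior P"
          using itin_tail[OF it t assms(3)] \<sigma> by metis
        have "(- w) \<bullet> n > 0" by (rule side_point_sign[OF n d(1)]) (simp add: d(2))
        ultimately show False by simp
      qed
      then show ?thesis using itin_extend[OF it q[OF t]] seg \<sigma> by simp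
    next
      fix h \<tau>
      assume t: "t > 0" and "\<sigma> = h # \<tau>" "itin P \<tau> z (z + t *\<^sub>R v)" "fold_map \<tau> (z + t *\<^sub>R v) = y"
          "side_point P y (fst h)" "y \<bullet> fst h = snd h"
      then show ?thesis using seg q[OF t] by auto
    qed
    have ts: "t + s > 0" using t0 move.hyps(2) by simp
    show ?thesis
    proof (cases "y + s *\<^sub>R w \<in> corners P")
      case True
      then show ?thesis using it ts y'[of s] unfolding hits_corner_def by auto
    next
      case False
      then show ?thesis using it ts y'[of s] \<sigma>(2) by blast
    qed
  qed
next
  case (reflect t y w n)
  show ?case
  proof (cases "hits_corner P z v t")
    case False
    then obtain \<sigma> where \<sigma>: "y = fold_map \<sigma> (z + t *\<^sub>R v)" "w = fold_dir \<sigma> v"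
      and cs: "t = 0 \<and> \<sigma> = [] \<or> t > 0 \<and> itin P \<sigma> z (z + t *\<^sub>R v) \<and> y \<notin> corners P \<or>
       (\<exists>h \<tau>. t > 0 \<and> \<sigma> = h # \<tau> \<and> itin P \<tau> z (z + t *\<^sub>R v) \<and> fold_map \<tau> (z + t *\<^sub>R v) = y \<and>
          side_point P y (fst h) \<and> y \<bullet> fst h = snd h \<and> w \<bullet> fst h > 0)"
      using reflect.IH by blast
    \<comment> \<open>Only an arrival can precede a reflection: at time 0 the orbit is in the
      interior, and just after a reflection \<open>w\<close> already points inwards.\<close>
    have "t > 0 \<and> itin P \<sigma> z (z + t *\<^sub>R v)"
      using cs
    proof (elim disjE conjE exE)
      assume "t = 0" "\<sigma> = []"
      then show ?thesis using \<sigma> assms(2) reflect.hyps(2) side_point_notin_interior by auto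
    next
      fix h \<tau> assume "side_point P y (fst h)" "w \<bullet> fst h > 0"
      then show ?thesis using side_point_unique[OF reflect.hyps(2)] reflect.hyps(3) by force
    qed auto
    moreover have "fold_map ((n, y \<bullet> n) # \<sigma>) (z + t *\<^sub>R v) = y" using \<sigma> by (simp add: mirror_def)
    moreover have "fold_dir ((n, y \<bullet> n) # \<sigma>) v = w - (2 * (w \<bullet> n)) *\<^sub>R n" using \<sigma> by simp
    moreover have "(w - (2 * (w \<bullet> n)) *\<^sub>R n) \<bullet> n > 0"
    proof -
      have "n \<bullet> n = 1" using side_point_norm[OF reflect.hyps(2)] by (simp flip: power2_norm_eq_inner)
      then show ?thesis using reflect.hyps(3) by (simp add: inner_diff_left)
    qed
    ultimately show ?thesis using \<sigma>(1) reflect.hyps(2)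
      by (intro disjI2 exI[of _ "(n, y \<bullet> n) # \<sigma>"]) auto
  qed simp
qed

corollary flow_corner_hits_corner:
  assumes "billiard_flow P z v t y w" "z \<in> interior P" "v \<noteq> 0" "t > 0" "y \<in> corners P"
  shows "hits_corner P z v t"
  using flow_itin[OF assms(1-3)] assms(4,5) by (auto simp: corners_def)

section \<open>Finiteness of corners and sides\<close>

text \<open>In the plane the vectors orthogonal to \<open>n\<close> form one line: the determinant
  of \<open>d\<close> and \<open>y\<close> vanishes.\<close>

lemma perp_parallel:
  fixes n d y :: "real^2"
  assumes "n \<noteq> 0" "n \<bullet> d = 0" "n \<bullet> y = 0" "d \<noteq> 0"
  obtains k where "y = k *\<^sub>R d"
proof -
  have *: "n$1 * d$1 + n$2 * d$2 = 0" "n$1 * y$1 + n$2 * y$2 = 0"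
    using assms by (auto simp: inner_vec_def sum_2)
  have "n$1 * (d$1 * y$2 - d$2 * y$1) = 0" "n$2 * (d$1 * y$2 - d$2 * y$1) = 0"
    using * by algebra+
  moreover have "n$1 \<noteq> 0 \<or> n$2 \<noteq> 0" using assms(1) by (auto simp: vec_eq_iff forall_2)
  ultimately have c: "d$1 * y$2 = d$2 * y$1" by auto
  have dd: "d$1 * d$1 + d$2 * d$2 \<noteq> 0" using assms(4) by (auto simp: vec_eq_iff forall_2 sum_squares_eq_zero_iff)
  \<comment> \<open>The coefficient of the orthogonal projection of \<open>y\<close> to the line of
    \<open>d\<close>.\<close>
  define k where "k = (y$1 * d$1 + y$2 * d$2) / (d$1 * d$1 + d$2 * d$2)"
  have k: "k * (d$1 * d$1 + d$2 * d$2) = y$1 * d$1 + y$2 * d$2" using dd by (simp add: k_def)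
  have "(k * d$1 - y$1) * (d$1 * d$1 + d$2 * d$2) = 0" "(k * d$2 - y$2) * (d$1 * d$1 + d$2 * d$2) = 0"
    using k c by algebra+
  then have "y = k *\<^sub>R d" using dd by (auto simp: vec_eq_iff forall_2)
  then show thesis by (rule that)
qed

lemma unit_normal_exists:
  fixes d :: "real^2" obtains n where "norm n = 1" "n \<bullet> d = 0"
proof -
  obtain y where y: "y \<noteq> 0" "orthogonal d y" using orthogonal_to_vector_exists[of d] by auto
  show thesis
    using y by (intro that[of "y /\<^sub>R norm y"]) (auto simp: orthogonal_def inner_commute)
qed

lemma unit_normal_unique:
  fixes d n m :: "real^2"
  assumes "d \<noteq> 0" "norm n = 1" "norm m = 1" "n \<bullet> d = 0" "m \<bullet> d = 0"
  shows "m = n \<or> m = - n"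
proof -
  have "n \<noteq> 0" using assms(2) by auto
  then obtain k where k: "m = k *\<^sub>R n"
    using perp_parallel[of d n m] assms by (metis inner_commute)
  then have "\<bar>k\<bar> = 1" using assms by simp
  then show ?thesis using k by (auto simp: abs_if split: if_splits)
qed

lemma finite_unit_normals:
  fixes d :: "real^2" assumes "d \<noteq> 0" shows "finite {n. norm n = 1 \<and> n \<bullet> d = 0}"
proof -
  obtain n where "norm n = 1" "n \<bullet> d = 0" using unit_normal_exists .
  then have "{n. norm n = 1 \<and> n \<bullet> d = 0} \<subseteq> {n, - n}"
    using unit_normal_unique[OF assms] by blast
  then show ?thesis by (rule finite_subset) simp
qed

lemma two_points_closed_segment:
  assumes "p \<in> closed_segment a b" "p' \<in> closed_segment a b" "p \<noteq> p'" 
  obtains k where "k \<noteq> 0" "p' - p = k *\<^sub>R (b - a)" "a \<noteq> b"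
proof -
  obtain u u' where u: "p = (1 - u) *\<^sub>R a + u *\<^sub>R b" "p' = (1 - u') *\<^sub>R a + u' *\<^sub>R b"
    using assms(1,2) by (auto simp: in_segment)
  have "p' - p = (u' - u) *\<^sub>R (b - a)" unfolding u by (simp add: algebra_simps)
  moreover have "u' - u \<noteq> 0" using assms(3) u by auto
  moreover have "a \<noteq> b" using assms by auto
  ultimately show thesis using that by blast
qed

text \<open>The side through \<open>x\<close> contains infinitely many frontier points, so by the
  pigeonhole principle one of the finitely many segments contains two of them and spans the same
  line. The point \<open>x\<close> itself need not lie on that segment.\<close>

lemma side_point_segment:
  assumes "side_point P x n" "finite S" "frontier P = (\<Union>(a, b)\<in>S. closed_segment a b)"
  obtains a b where "(a, b) \<in> S" "a \<noteq> b" "n \<bullet> (b - a) = 0" "x \<bullet> n = a \<bullet> n"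
proof -
  obtain r where r: "r > 0" "\<And>y. y \<in> ball x r \<Longrightarrow> (y - x) \<bullet> n = 0 \<Longrightarrow> side_point P y n"
    using side_point_near[OF assms(1)] by metis
  obtain e where e: "norm e = 1" "e \<bullet> n = 0" using unit_normal_exists .
  have "x + s *\<^sub>R e \<in> frontier P" if "s \<in> {0<..<r}" for s
    using r(2)[of "x + s *\<^sub>R e"] e that by (auto simp: dist_norm side_point_def)
  then have sub: "\<forall>s\<in>{0<..<r}. \<exists>ab\<in>S. x + s *\<^sub>R e \<in> closed_segment (fst ab) (snd ab)"
    unfolding assms(3) by force
  have "infinite {0<..<r}" using r(1) by (simp add: infinite_Ioo)
  from pigeonhole_infinite_rel[OF this assms(2) sub] obtain ab
    where ab: "ab \<in> S" "infinite {s \<in> {0<..<r}. x + s *\<^sub>R e \<in> closed_segment (fst ab) (snd ab)}" by blast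
  obtain a b where [simp]: "ab = (a, b)" by fastforce
  let ?I = "{s \<in> {0<..<r}. x + s *\<^sub>R e \<in> closed_segment a b}"
  have inf: "infinite ?I" using ab(2) by simp
  obtain s where s: "s \<in> ?I" using infinite_imp_nonempty[OF inf] by blast
  obtain s' where s': "s' \<in> ?I - {s}" using infinite_imp_nonempty[OF infinite_remove[OF inf, of s]] by blast
  have "e \<noteq> 0" using e(1) by auto
  then obtain k where k: "k \<noteq> 0" "(x + s' *\<^sub>R e) - (x + s *\<^sub>R e) = k *\<^sub>R (b - a)" "a \<noteq> b"
    using two_points_closed_segment[of "x + s *\<^sub>R e" a b "x + s' *\<^sub>R e"] s s' by auto
  have "(k *\<^sub>R (b - a)) \<bullet> n = 0" using k(2)[symmetric] e(2) by (simp add: inner_diff_left)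
  then have 1: "(b - a) \<bullet> n = 0" using k(1) by simp
  obtain u where "x + s *\<^sub>R e = (1 - u) *\<^sub>R a + u *\<^sub>R b" using s by (auto simp: in_segment)
  then have "x + s *\<^sub>R e = a + u *\<^sub>R (b - a)" by (simp add: algebra_simps)
  then have "(x + s *\<^sub>R e) \<bullet> n = (a + u *\<^sub>R (b - a)) \<bullet> n" by simp
  then have "x \<bullet> n = a \<bullet> n" using e(2) 1 by (simp add: inner_add_left)
  then show thesis using that ab(1) k(3) 1 by (simp add: inner_commute)
qed

text \<open>A letter is determined by a nondegenerate segment and one of its two unit
  normals.\<close>

lemma finite_side_lines:
  assumes "finite S" "frontier P = (\<Union>(a, b)\<in>S. closed_segment a b)"
  shows "finite (side_lines P)"
proof -
  have "side_lines P \<subseteq> (\<Union>(a, b)\<in>{(a, b)\<in>S. a \<noteq> b}. (\<lambda>n. (n, a \<bullet> n)) ` {n. norm n = 1 \<and> n \<bullet> (b - a) = 0})"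
  proof
    fix h assume "h \<in> side_lines P"
    then obtain n x where h: "h = (n, x \<bullet> n)" "side_point P x n" unfolding side_lines_def by auto
    obtain a b where "(a, b) \<in> S" "a \<noteq> b" "n \<bullet> (b - a) = 0" "x \<bullet> n = a \<bullet> n"
      using side_point_segment[OF h(2) assms] .
    then show "h \<in> (\<Union>(a, b)\<in>{(a, b)\<in>S. a \<noteq> b}. (\<lambda>n. (n, a \<bullet> n)) ` {n. norm n = 1 \<and> n \<bullet> (b - a) = 0})"
      using h side_point_norm[OF h(2)] by auto
  qed
  moreover have "finite {(a, b)\<in>S. a \<noteq> b}" using assms(1) by (rule finite_subset[rotated]) auto
  then have "finite (\<Union>(a, b)\<in>{(a, b)\<in>S. a \<noteq> b}. (\<lambda>n. (n, a \<bullet> n)) ` {n. norm n = 1 \<and> n \<bullet> (b - a) = 0})"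
    by (rule finite_UN_I) (auto intro!: finite_imageI finite_unit_normals)
  ultimately show ?thesis by (rule finite_subset)
qed

text \<open>Each open half of the disc is connected and misses the frontier, so it lies inside or
  outside \<open>P\<close>. If both were inside, \<open>x\<close> would be interior; if both were
  outside, interior points near \<open>x\<close> would lie on the diameter, which is frontier. So
  exactly one half belongs to \<open>P\<close>.\<close>

lemma side_point_of_flat_frontier:
  assumes P: "closed P" "closure (interior P) = P" and x: "x \<in> frontier P" and n: "norm n = 1"
    and r: "r > 0" "frontier P \<inter> ball x r = {y \<in> ball x r. (y - x) \<bullet> n = 0}"
  shows "\<exists>m. side_point P x m"
proof -
  have half: "connected (ball x r \<inter> {y. (y - x) \<bullet> m > 0})" for m :: "real^2"
  proof -
    have "{y. (y - x) \<bullet> m > 0} = {y. m \<bullet> y > m \<bullet> x}" by (auto simp: inner_diff_left inner_commute[of m])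
    then show ?thesis by (simp add: convex_connected convex_Int convex_halfspace_gt)
  qed
  have dich: "ball x r \<inter> {y. (y - x) \<bullet> m > 0} \<subseteq> P \<or> ball x r \<inter> {y. (y - x) \<bullet> m > 0} \<inter> P = {}"
    if "m = n \<or> m = - n" for m
  proof (rule ccontr)
    assume "\<not> ?thesis"
    then have "ball x r \<inter> {y. (y - x) \<bullet> m > 0} \<inter> frontier P \<noteq> {}"
      by (intro connected_Int_frontier half) auto
    then obtain y where "y \<in> frontier P \<inter> ball x r" "(y - x) \<bullet> m > 0" by blast
    moreover from this(1) have "(y - x) \<bullet> n = 0" unfolding r(2) by simp
    ultimately show False using that by auto
  qed
  have line: "ball x r \<inter> {y. (y - x) \<bullet> n = 0} \<subseteq> P"
    using r(2) frontier_subset_closed[OF P(1)] by blast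
  have sp: "side_point P x m"
    if m: "m = n \<or> m = - n" "ball x r \<inter> {y. (y - x) \<bullet> m > 0} \<subseteq> P" "ball x r \<inter> {y. (y - x) \<bullet> (- m) > 0} \<inter> P = {}" for m
  proof -
    have "P \<inter> ball x r = {y \<in> ball x r. (y - x) \<bullet> m \<ge> 0}"
    proof (intro equalityI subsetI)
      fix y assume "y \<in> P \<inter> ball x r" then show "y \<in> {y \<in> ball x r. (y - x) \<bullet> m \<ge> 0}"
        using m(3) by (force simp: not_le)
    next
      fix y assume y: "y \<in> {y \<in> ball x r. (y - x) \<bullet> m \<ge> 0}"
      show "y \<in> P \<inter> ball x r"
      proof (cases "(y - x) \<bullet> m = 0")
        case True then have "(y - x) \<bullet> n = 0" using m(1) by auto
        then show ?thesis using y line by auto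
      next
        case False then show ?thesis using y m(2) by auto
      qed
    qed
    moreover have "norm m = 1" using m(1) n by auto
    ultimately show ?thesis using x r(1) unfolding side_point_def by blast
  qed
  let ?H = "\<lambda>m. ball x r \<inter> {y. (y - x) \<bullet> m > 0}"
  have "\<not> (?H n \<subseteq> P \<and> ?H (- n) \<subseteq> P)"
  proof
    assume *: "?H n \<subseteq> P \<and> ?H (- n) \<subseteq> P"
    have "ball x r \<subseteq> P"
    proof
      fix y assume y: "y \<in> ball x r"
      consider "(y - x) \<bullet> n > 0" | "(y - x) \<bullet> n = 0" | "(y - x) \<bullet> (- n) > 0" by fastforce
      then show "y \<in> P" using * line y by cases blast+
    qed
    then have "x \<in> interior P" using r(1) by (meson centre_in_ball interior_maximal open_ball subsetD)
    then show False using x by (simp add: frontier_def)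
  qed
  moreover have "\<not> (?H n \<inter> P = {} \<and> ?H (- n) \<inter> P = {})"
  proof
    assume *: "?H n \<inter> P = {} \<and> ?H (- n) \<inter> P = {}"
    have "x \<in> closure (interior P)" using x P frontier_subset_closed by blast
    then obtain y where y: "y \<in> interior P" "dist y x < r" using r(1) by (meson closure_approachable)
    then have yb: "y \<in> ball x r" "y \<in> P" using interior_subset by (auto simp: dist_commute)
    consider "(y - x) \<bullet> n > 0" | "(y - x) \<bullet> n = 0" | "(y - x) \<bullet> (- n) > 0" by fastforce
    then show False
    proof cases
      case 2 then have "y \<in> frontier P" using r(2) yb by blast
      then show ?thesis using y(1) by (simp add: frontier_def)
    qed (use * yb in blast)+
  qed
  ultimately show ?thesis using dich[of n] dich[of "- n"] sp[of n] sp[of "- n"] by auto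
qed

text \<open>Away from the end points of the segments and the crossings of nonparallel ones, all
  segments through a frontier point lie on one line and the others keep a positive distance. There
  the frontier is locally a diameter of a disc, so the point is a side point.\<close>

lemma finite_corners:
  assumes P: "closed P" "closure (interior P) = P"
    and S: "finite S" "frontier P = (\<Union>(a, b)\<in>S. closed_segment a b)"
  shows "finite (corners P)"
proof -
  \<comment> \<open>Parallelism as a common unit normal, so that a degenerate segment is parallel to
    every segment; its only point is in \<open>X\<close> as an end point.\<close>
  define par where "par = (\<lambda>(a, b) (c, d). \<exists>n::real^2. norm n = 1 \<and> n \<bullet> (b - a) = 0 \<and> n \<bullet> (d - c) = 0)"
  define seg where "seg = (\<lambda>(a, b). closed_segment a (b :: real^2))"
  define X where "X = fst ` S \<union> snd ` S \<union> (\<Union>s\<in>S. \<Union>t\<in>S. if par s t then {} else seg s \<inter> seg t)"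
  have one: "finite (seg s \<inter> seg t)" if "\<not> par s t" for s t
  proof -
    obtain a b c d where [simp]: "s = (a, b)" "t = (c, d)" by fastforce
    have "p = p'" if p: "p \<in> seg s \<inter> seg t" "p' \<in> seg s \<inter> seg t" for p p'
    proof (rule ccontr)
      assume "p \<noteq> p'"
      then obtain k where k: "k \<noteq> 0" "p' - p = k *\<^sub>R (b - a)"
        using p two_points_closed_segment[of p a b p'] by (auto simp: seg_def)
      obtain l where l: "l \<noteq> 0" "p' - p = l *\<^sub>R (d - c)"
        using \<open>p \<noteq> p'\<close> p two_points_closed_segment[of p c d p'] by (auto simp: seg_def)
      obtain n where n: "norm n = 1" "n \<bullet> (p' - p) = 0" using unit_normal_exists .
      have "n \<bullet> (b - a) = 0" using n(2) k unfolding k(2) by simp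
      moreover have "n \<bullet> (d - c) = 0" using n(2) l unfolding l(2) by simp
      ultimately show False using \<open>\<not> par s t\<close> n(1) by (auto simp: par_def)
    qed
    then have "\<exists>p. seg s \<inter> seg t \<subseteq> {p}" by blast
    then show ?thesis using finite_subset by blast
  qed
  have "finite X" unfolding X_def using S(1) one
    by (intro finite_UnI finite_imageI finite_UN_I) (simp_all split: if_split)
  moreover have "corners P \<subseteq> X"
  proof (rule ccontr)
    assume "\<not> corners P \<subseteq> X"
    then obtain x where x: "x \<in> frontier P" "\<nexists>n. side_point P x n" "x \<notin> X"
      unfolding corners_def by blast
    have opn: "x \<in> open_segment a b" if "(a, b) \<in> S" "x \<in> closed_segment a b" for a b
    proof -
      have "a \<in> fst ` S" "b \<in> snd ` S" using that(1) by (force intro: image_eqI)+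
      then have "x \<noteq> a" "x \<noteq> b" using x(3) by (auto simp: X_def)
      then show ?thesis using that(2) by (simp add: open_segment_def)
    qed
    obtain a b where ab: "(a, b) \<in> S" "x \<in> closed_segment a b" using x(1) S(2) by auto
    have xo: "x \<in> open_segment a b" using opn[OF ab] .
    then have nab: "b - a \<noteq> 0" by auto
    obtain n where n: "norm n = 1" "n \<bullet> (b - a) = 0" using unit_normal_exists .
    have on_line: "(y - x) \<bullet> n = 0" if cd: "(c, d) \<in> S" "x \<in> closed_segment c d" "y \<in> closed_segment c d" for c d y
    proof (cases "y = x")
      case False
      then obtain k where k: "y - x = k *\<^sub>R (d - c)" using two_points_closed_segment cd by metis
      have "par (a, b) (c, d)" 
      proof (rule ccontr)
        assume "\<not> par (a, b) (c, d)"
        then have "x \<in> (if par (a, b) (c, d) then {} else seg (a, b) \<inter> seg (c, d))"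
          using ab(2) cd(2) by (simp add: seg_def)
        then have "x \<in> X" unfolding X_def using ab(1) cd(1) by blast
        then show False using x(3) by blast
      qed
      then obtain m where m: "norm m = 1" "m \<bullet> (b - a) = 0" "m \<bullet> (d - c) = 0" by (auto simp: par_def)
      then have "n = m \<or> n = - m" using unit_normal_unique[OF nab] n by blast
      then have "n \<bullet> (d - c) = 0" using m by auto
      then show ?thesis unfolding k by (simp add: inner_commute)
    qed simp
    define T where "T = {s \<in> S. x \<notin> seg s}"
    have cl: "closed (\<Union> (seg ` T))" using S(1) by (intro closed_Union) (auto simp: T_def seg_def)
    have "x \<in> - \<Union> (seg ` T)" by (auto simp: T_def)
    then obtain r1 where "r1 > 0" "ball x r1 \<subseteq> - \<Union> (seg ` T)"
      using openE[OF open_Compl[OF cl]] by metis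
    then have r1: "r1 > 0" "ball x r1 \<inter> \<Union> (seg ` T) = {}" by auto
    obtain u where u: "0 < u" "u < 1" "x = (1 - u) *\<^sub>R a + u *\<^sub>R b" using xo by (auto simp: in_segment)
    \<comment> \<open>The bound \<open>r1\<close> avoids the segments that miss \<open>x\<close>;
      the other term is the distance from \<open>x\<close> to the nearer end of its segment, so that
      the whole diameter is frontier.\<close>
    define r where "r = min r1 (min u (1 - u) * norm (b - a))"
    have r0: "r > 0" using r1(1) u nab by (simp add: r_def)
    have "frontier P \<inter> ball x r = {y \<in> ball x r. (y - x) \<bullet> n = 0}"
    proof (intro equalityI subsetI)
      fix y assume y: "y \<in> frontier P \<inter> ball x r"
      then obtain c d where cd: "(c, d) \<in> S" "y \<in> closed_segment c d" using S(2) by auto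
      have "x \<in> closed_segment c d"
      proof (rule ccontr)
        assume "x \<notin> closed_segment c d"
        then have "y \<in> \<Union> (seg ` T)" using cd by (auto simp: T_def seg_def)
        moreover have "y \<in> ball x r1" using y by (auto simp: r_def)
        ultimately show False using r1(2) by blast
      qed
      then show "y \<in> {y \<in> ball x r. (y - x) \<bullet> n = 0}" using on_line cd y by auto
    next
      fix y assume y: "y \<in> {y \<in> ball x r. (y - x) \<bullet> n = 0}"
      then have "n \<bullet> (y - x) = 0" by (simp add: inner_commute[of n])
      moreover have "n \<noteq> 0" using n(1) by auto
      ultimately obtain k where k: "y - x = k *\<^sub>R (b - a)"
        using perp_parallel n(2) nab by blast
      have "norm (y - x) < min u (1 - u) * norm (b - a)"
        using y by (simp add: r_def dist_norm norm_minus_commute)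
      then have "\<bar>k\<bar> < min u (1 - u)" using nab unfolding k by simp
      then have "0 \<le> u + k" "u + k \<le> 1" by auto
      moreover have "y = (1 - (u + k)) *\<^sub>R a + (u + k) *\<^sub>R b"
      proof -
        have "y = x + k *\<^sub>R (b - a)" using k by (simp add: algebra_simps)
        then show ?thesis unfolding u(3) by (simp add: algebra_simps)
      qed
      ultimately have "y \<in> closed_segment a b" by (auto simp: in_segment)
      then show "y \<in> frontier P \<inter> ball x r" using ab(1) y S(2) by auto
    qed
    from side_point_of_flat_frontier[OF P x(1) n(1) r0 this] x(2) show False by blast
  qed
  ultimately show ?thesis by (rule finite_subset[rotated])
qed

lemma negligible_closed_segment:
  fixes a b :: "real^2" shows "negligible (closed_segment a b)"
proof -
  obtain n where n: "norm n = 1" "n \<bullet> (b - a) = 0" using unit_normal_exists .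
  have "closed_segment a b \<subseteq> {x. n \<bullet> x = n \<bullet> a}"
  proof
    fix x assume "x \<in> closed_segment a b"
    then obtain u where "x = (1 - u) *\<^sub>R a + u *\<^sub>R b" by (auto simp: in_segment)
    then have "x = a + u *\<^sub>R (b - a)" by (simp add: algebra_simps)
    then show "x \<in> {x. n \<bullet> x = n \<bullet> a}" using n(2) by (simp add: inner_add_right)
  qed
  moreover have "negligible {x. n \<bullet> x = n \<bullet> a}" using n(1) by (intro negligible_hyperplane) auto
  ultimately show ?thesis by (rule negligible_subset[rotated])
qed

section \<open>Measurability of itineraries\<close>

lemma open_all_compact:
  fixes h :: "'a::topological_space \<times> real \<Rightarrow> 'b::topological_space"
  assumes "compact K" "open U" "continuous_on UNIV h"
  shows "open {p. \<forall>u\<in>K. h (p, u) \<in> U}"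
proof (subst open_subopen, intro ballI)
  fix p assume "p \<in> {p. \<forall>u\<in>K. h (p, u) \<in> U}"
  then have sub: "{p} \<times> K \<subseteq> h -` U" by auto
  have "open (h -` U)" using assms(2,3) by (rule open_vimage)
  from Elementary_Topology.tube_lemma[OF assms(1) this sub]
  obtain X where "p \<in> X" "open X" "X \<times> K \<subseteq> h -` U" by blast
  then show "\<exists>T. open T \<and> p \<in> T \<and> T \<subseteq> {p. \<forall>u\<in>K. h (p, u) \<in> U}" by blast
qed

text \<open>The open unit interval is exhausted by the compact intervals \<open>K n\<close>, and by
  the tube lemma the condition over each \<open>K n\<close> is open in the pair of end
  points.\<close>

lemma borel_open_segment_subset:
  fixes f g :: "real^2 \<Rightarrow> real^2"
  assumes [measurable]: "f \<in> borel_measurable borel" "g \<in> borel_measurable borel" and U: "open U"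
  shows "{z. open_segment (f z) (g z) \<subseteq> U} \<in> sets borel"
proof -
  define K where "K n = {1 / real (n + 2) .. 1 - 1 / real (n + 2)}" for n
  define h where "h = (\<lambda>(p, u). (1 - u) *\<^sub>R fst p + u *\<^sub>R snd (p :: (real^2) \<times> (real^2)))"
  have K: "u \<in> K n \<Longrightarrow> 0 < u \<and> u < 1" for u n
    unfolding K_def by (auto intro: less_le_trans[of 0 "1 / real (n + 2)"] le_less_trans[of _ "1 - 1 / real (n + 2)"])
  have K': "\<exists>n. u \<in> K n" if "0 < u" "u < 1" for u
  proof -
    have "min u (1 - u) > 0" using that by simp
    then obtain n where "n > 0" "inverse (real n) < min u (1 - u)"
      using ex_inverse_of_nat_less by blast
    moreover have "1 / real (n + 2) \<le> inverse (real n)" using \<open>n > 0\<close> by (simp add: field_simps)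
    ultimately show ?thesis unfolding K_def by (intro exI[of _ n]) auto
  qed
  \<comment> \<open>For \<open>a = b\<close> the open segment is empty, whereas \<open>h\<close>
    would test the point \<open>a\<close>.\<close>
  have seg: "open_segment a b \<subseteq> U \<longleftrightarrow> a = b \<or> (\<forall>n. \<forall>u\<in>K n. h ((a, b), u) \<in> U)" for a b
  proof (cases "a = b")
    case False
    then have "open_segment a b \<subseteq> U \<longleftrightarrow> (\<forall>u. 0 < u \<and> u < 1 \<longrightarrow> h ((a, b), u) \<in> U)"
      by (auto simp: open_segment_image_interval h_def)
    then show ?thesis using K K' False by metis
  qed simp
  have "continuous_on UNIV h" unfolding h_def case_prod_unfold by (intro continuous_intros)
  then have "open {p. \<forall>u\<in>K n. h (p, u) \<in> U}" for n
    using open_all_compact[of "K n" U h] U by (simp add: K_def)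
  then have K_sets: "{p. \<forall>u\<in>K n. h (p, u) \<in> U} \<in> sets borel" for n by simp
  have pair: "(\<lambda>z. (f z, g z)) \<in> borel_measurable borel" by simp
  have "{z. \<forall>u\<in>K n. h ((f z, g z), u) \<in> U} = (\<lambda>z. (f z, g z)) -` {p. \<forall>u\<in>K n. h (p, u) \<in> U} \<inter> space borel" for n
    by auto
  then have "{z. \<forall>u\<in>K n. h ((f z, g z), u) \<in> U} \<in> sets borel" for n
    using measurable_sets[OF pair K_sets] by simp
  then have "{z. f z = g z} \<union> (\<Inter>n. {z. \<forall>u\<in>K n. h ((f z, g z), u) \<in> U}) \<in> sets borel"
    by (intro sets.Un sets.countable_INT) auto
  also have "{z. f z = g z} \<union> (\<Inter>n. {z. \<forall>u\<in>K n. h ((f z, g z), u) \<in> U}) = {z. open_segment (f z) (g z) \<subseteq> U}"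
    unfolding seg by auto
  finally show ?thesis .
qed

text \<open>By \<open>side_point_near\<close> the set is relatively open in a closed line.\<close>

lemma borel_side_points: "{x. side_point P x n \<and> x \<bullet> n = c} \<in> sets borel"
proof -
  define V where "V = \<Union>{U. open U \<and> (\<forall>y\<in>U. y \<bullet> n = c \<longrightarrow> side_point P y n)}"
  have "{x. side_point P x n \<and> x \<bullet> n = c} = {x. x \<bullet> n = c} \<inter> V"
  proof (intro equalityI subsetI)
    fix x assume x: "x \<in> {x. side_point P x n \<and> x \<bullet> n = c}"
    then obtain r where r: "r > 0" "\<And>y. y \<in> ball x r \<Longrightarrow> (y - x) \<bullet> n = 0 \<Longrightarrow> side_point P y n"
      using side_point_near[of P x n] by auto
    then have "\<forall>y\<in>ball x r. y \<bullet> n = c \<longrightarrow> side_point P y n" using x by (simp add: inner_diff_left)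
    moreover have "x \<in> ball x r" using r(1) by simp
    ultimately have "x \<in> V" unfolding V_def by blast
    then show "x \<in> {x. x \<bullet> n = c} \<inter> V" using x by blast
  qed (auto simp: V_def)
  moreover have "open V" unfolding V_def by blast
  moreover have "closed {x. x \<bullet> n = c}" by (intro closed_Collect_eq continuous_intros)
  ultimately show ?thesis by (simp add: borel_open borel_closed sets.Int)
qed

lemma borel_fold_map [measurable]: "fold_map \<sigma> \<in> borel_measurable borel"
proof -
  have "continuous_on UNIV (fold_dir \<sigma>)" using linear_fold_dir linear_continuous_on linear_conv_bounded_linear by blast
  then have "continuous_on UNIV (\<lambda>x. fold_map \<sigma> 0 + fold_dir \<sigma> x)" by (intro continuous_intros)
  then have "(\<lambda>x. fold_map \<sigma> 0 + fold_dir \<sigma> x) \<in> borel_measurable borel" by (rule borel_measurable_continuous_onI)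
  then show ?thesis using fold_map_eq[of \<sigma>] by argo
qed

lemma borel_fold_dir [measurable]: "fold_dir \<sigma> \<in> borel_measurable borel"
  using linear_fold_dir linear_continuous_on linear_conv_bounded_linear
  by (blast intro: borel_measurable_continuous_onI)

text \<open>The last impact is forced to be the crossing of the segment with the unfolded side line,
  so the existential quantifier over \<open>q\<close> becomes a measurable function of
  \<open>z\<close>. The induction needs a variable end point \<open>f z\<close> because this
  crossing moves with \<open>z\<close>.\<close>

lemma borel_itin:
  assumes "f \<in> borel_measurable borel"
  shows "{z. itin P \<sigma> z (f z)} \<in> sets borel"
  using assms
proof (induction \<sigma> arbitrary: f)
  case Nil
  have "{z. open_segment (id z) (f z) \<subseteq> interior P} \<in> sets borel"
    using Nil by (intro borel_open_segment_subset) auto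
  moreover have "interior P \<in> sets borel" by simp
  ultimately have "interior P \<inter> {z. open_segment (id z) (f z) \<subseteq> interior P} \<in> sets borel" by (rule sets.Int[rotated])
  also have "interior P \<inter> {z. open_segment (id z) (f z) \<subseteq> interior P} = {z. itin P [] z (f z)}" by auto
  finally show ?case .
next
  case (Cons h \<sigma>)
  note [measurable] = Cons.prems
  show ?case
  proof (cases "h # \<sigma> \<in> lists (side_lines P)")
    case False
    then have "{z. itin P (h # \<sigma>) z (f z)} = {}" using itin_side_lines by blast
    then show ?thesis by (simp only: sets.empty_sets)
  next
    case True
    note un = unit_normals_side_lines[OF True]
    define n c where "n = fst h" and "c = snd h"
    \<comment> \<open>the parameter at which the segment from \<open>z\<close> to \<open>f z\<close> crosses the unfolded line \<open>h\<close>;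
      it is \<open>0\<close> (division by zero) if they are parallel\<close>
    define s where "s z = (c - fold_map \<sigma> z \<bullet> n) / (fold_dir \<sigma> (f z - z) \<bullet> n)" for z
    define q where "q z = z + s z *\<^sub>R (f z - z)" for z
    have [measurable]: "s \<in> borel_measurable borel" unfolding s_def by measurable
    have [measurable]: "q \<in> borel_measurable borel" unfolding q_def by measurable
    have iff: "itin P (h # \<sigma>) z (f z) \<longleftrightarrow> 0 < s z \<and> s z < 1 \<and> itin P \<sigma> z (q z) \<and>
      (side_point P (fold_map \<sigma> (q z)) n \<and> fold_map \<sigma> (q z) \<bullet> n = c) \<and>
      open_segment (fold_map (h # \<sigma>) (q z)) (fold_map (h # \<sigma>) (f z)) \<subseteq> interior P" for z
    proof
      assume "itin P (h # \<sigma>) z (f z)"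
      then obtain p where p: "p \<in> open_segment z (f z)" "itin P \<sigma> z p" "side_point P (fold_map \<sigma> p) n"
        "fold_map \<sigma> p \<bullet> n = c" "fold_map (h # \<sigma>) ` open_segment p (f z) \<subseteq> interior P"
        by (auto simp: n_def c_def)
      have ne: "f z - z \<noteq> 0" using p(1) by auto
      obtain r where r: "0 < r" "r < 1" "p = z + r *\<^sub>R (f z - z)"
        using p(1) open_segment_ray[OF ne, of 0 1 z] by auto
      \<comment> \<open>The orbit arrives from the interior, hence transversally: the denominator of
        \<open>s z\<close> is not 0 and the crossing parameter is unique.\<close>
      obtain d where d: "d > 0" "\<And>r. 0 < r \<Longrightarrow> r < d \<Longrightarrow> fold_map \<sigma> p - r *\<^sub>R fold_dir \<sigma> (f z - z) \<in> interior P"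
        using itin_tail[of P \<sigma> z r "f z - z"] p(2) r(1) ne unfolding r(3) by metis
      have "(- fold_dir \<sigma> (f z - z)) \<bullet> n > 0"
        by (rule side_point_sign[OF p(3) d(1)]) (simp add: d(2))
      moreover have "fold_map \<sigma> z \<bullet> n + r * (fold_dir \<sigma> (f z - z) \<bullet> n) = c"
        using p(4) unfolding r(3) fold_map_add_scaleR by (simp add: inner_add_left)
      ultimately have "r = s z" unfolding s_def by (simp add: field_simps)
      then have "p = q z" using r(3) by (simp add: q_def)
      then show "0 < s z \<and> s z < 1 \<and> itin P \<sigma> z (q z) \<and>
        (side_point P (fold_map \<sigma> (q z)) n \<and> fold_map \<sigma> (q z) \<bullet> n = c) \<and>
        open_segment (fold_map (h # \<sigma>) (q z)) (fold_map (h # \<sigma>) (f z)) \<subseteq> interior P"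
        using p r \<open>r = s z\<close> fold_map_open_segment[OF un, of p "f z"] by simp
    next
      assume *: "0 < s z \<and> s z < 1 \<and> itin P \<sigma> z (q z) \<and>
        (side_point P (fold_map \<sigma> (q z)) n \<and> fold_map \<sigma> (q z) \<bullet> n = c) \<and>
        open_segment (fold_map (h # \<sigma>) (q z)) (fold_map (h # \<sigma>) (f z)) \<subseteq> interior P"
      have "f z - z \<noteq> 0"
      proof
        assume "f z - z = 0"
        then have "s z = 0" unfolding s_def using linear_0[OF linear_fold_dir] by simp
        then show False using * by simp
      qed
      then have "q z \<in> open_segment z (f z)" using * open_segment_ray[of "f z - z" 0 1 z] by (auto simp: q_def)
      moreover have "fold_map (h # \<sigma>) ` open_segment (q z) (f z) \<subseteq> interior P"
        using * fold_map_open_segment[OF un, of "q z" "f z"] by simp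
      ultimately show "itin P (h # \<sigma>) z (f z)" using * by (auto simp: n_def c_def)
    qed
    have 1: "{z. 0 < s z} \<in> sets borel" "{z. s z < 1} \<in> sets borel" by simp_all
    have 2: "{z. itin P \<sigma> z (q z)} \<in> sets borel" by (rule Cons.IH) simp
    have fq: "(\<lambda>z. fold_map \<sigma> (q z)) \<in> borel_measurable borel" by simp
    have 3: "{z. side_point P (fold_map \<sigma> (q z)) n \<and> fold_map \<sigma> (q z) \<bullet> n = c} \<in> sets borel"
      using measurable_sets[OF fq borel_side_points[of P n c]] by (simp add: vimage_def)
    have 4: "{z. open_segment (fold_map (h # \<sigma>) (q z)) (fold_map (h # \<sigma>) (f z)) \<subseteq> interior P} \<in> sets borel"
      by (intro borel_open_segment_subset measurable_compose[OF _ borel_fold_map]) simp_all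
    have "{z. itin P (h # \<sigma>) z (f z)} = {z. 0 < s z} \<inter> ({z. s z < 1} \<inter> ({z. itin P \<sigma> z (q z)} \<inter>
      ({z. side_point P (fold_map \<sigma> (q z)) n \<and> fold_map \<sigma> (q z) \<bullet> n = c} \<inter>
      {z. open_segment (fold_map (h # \<sigma>) (q z)) (fold_map (h # \<sigma>) (f z)) \<subseteq> interior P})))"
      unfolding iff by blast
    also have "\<dots> \<in> sets borel" by (intro sets.Int 1 2 3 4)
    finally show ?thesis .
  qed
qed

section \<open>Components of the punctured circle\<close>

text \<open>Every component is the component of the point chosen in some \<open>A j\<close>, so
  \<open>J\<close> maps onto a superset of the components.\<close>

lemma components_UN_connected:
  fixes A :: "'i \<Rightarrow> 'a::topological_space set"
  assumes "finite J" "\<And>j. j \<in> J \<Longrightarrow> connected (A j)"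
  shows "finite (components (\<Union>j\<in>J. A j)) \<and> card (components (\<Union>j\<in>J. A j)) \<le> card J"
proof -
  let ?U = "\<Union>j\<in>J. A j"
  let ?c = "\<lambda>j. connected_component_set ?U (SOME x. x \<in> A j)"
  have "components ?U \<subseteq> ?c ` J"
  proof
    fix C assume "C \<in> components ?U"
    then obtain x where x: "x \<in> ?U" "C = connected_component_set ?U x" by (auto simp: components_def)
    then obtain j where j: "j \<in> J" "x \<in> A j" by blast
    have "(SOME x. x \<in> A j) \<in> A j" using j(2) by (rule someI)
    then have "connected_component ?U x (SOME x. x \<in> A j)"
      unfolding connected_component_def using assms(2)[OF j(1)] j by blast
    then have "C = ?c j" using x(2) connected_component_eq[of "SOME x. x \<in> A j" ?U x] by simp
    then show "C \<in> ?c ` J" using j(1) by blast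
  qed
  then show ?thesis using assms(1) by (meson finite_imageI finite_subset surj_card_le)
qed

definition circle_path :: "real \<Rightarrow> real^2" where
  "circle_path t = vector [cos t, sin t]"

lemma circle_path_nth [simp]: "circle_path t $ 1 = cos t" "circle_path t $ 2 = sin t"
  by (simp_all add: circle_path_def)

lemma continuous_circle_path: "continuous_on S circle_path"
proof -
  have "continuous_on S (\<lambda>t. circle_path t $ i)" for i
  proof -
    have "i = 1 \<or> i = 2" by (rule exhaust_2)
    then show ?thesis
    proof
      assume "i = 1" then show ?thesis by (simp add: continuous_on_cos[OF continuous_on_id])
    next
      assume "i = 2" then show ?thesis by (simp add: continuous_on_sin[OF continuous_on_id])
    qed
  qed
  then have "continuous_on S (\<lambda>t. \<chi> i. circle_path t $ i)" by (rule continuous_on_vec_lambda)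
  then show ?thesis by simp
qed

lemma circle_path_image: "circle_path ` {0..<2 * pi} = sphere 0 1"
proof (intro equalityI subsetI)
  fix v :: "real^2" assume "v \<in> sphere 0 1"
  then have "(v $ 1)\<^sup>2 + (v $ 2)\<^sup>2 = 1" by (simp add: norm_vec_def L2_set_def sum_2)
  then obtain t where "0 \<le> t" "t < 2 * pi" "v $ 1 = cos t" "v $ 2 = sin t"
    using sincos_total_2pi by metis
  moreover from this have "v = circle_path t" by (simp add: vec_eq_iff forall_2)
  ultimately show "v \<in> circle_path ` {0..<2 * pi}" by auto
qed (auto simp: norm_vec_def L2_set_def sum_2)

lemma inj_circle_path: "inj_on circle_path {0..<2 * pi}"
proof (rule inj_onI)
  fix s t assume st: "s \<in> {0..<2 * pi}" "t \<in> {0..<2 * pi}" "circle_path s = circle_path t"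
  then have "sin s = sin t \<and> cos s = cos t" by (metis circle_path_nth)
  then obtain n :: int where n: "s = t + 2 * pi * n" using sin_cos_eq_iff by metis
  have "\<bar>2 * pi * n\<bar> < 2 * pi" using st n by auto
  then have "2 * pi * \<bar>real_of_int n\<bar> < 2 * pi * 1" by (simp add: abs_mult)
  then have "\<bar>real_of_int n\<bar> < 1" by (subst (asm) mult_less_cancel_left_pos) simp_all
  then have "n = 0" by linarith
  then show "s = t" using n by simp
qed

text \<open>Cut open at angle 0, the circle is an interval, which falls into at most
  \<open>card T + 1\<close> intervals when the points of \<open>T\<close> are removed.\<close>

lemma components_circle_minus_finite:
  fixes B :: "(real^2) set"
  assumes "finite B"
  shows "finite (components (sphere 0 1 - B)) \<and> card (components (sphere 0 1 - B)) \<le> card B + 1"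
proof -
  define T where "T = {t \<in> {0..<2 * pi}. circle_path t \<in> B}"
  have "inj_on circle_path T" by (rule inj_on_subset[OF inj_circle_path]) (auto simp: T_def)
  moreover have "circle_path ` T \<subseteq> B" by (auto simp: T_def)
  ultimately have T: "finite T" "card T \<le> card B"
    using assms by (auto intro: inj_on_finite card_inj_on_le)
  \<comment> \<open>The gap after the first \<open>k\<close> removed parameters. A removed parameter
    between two points of it would make their counts differ.\<close>
  define A where "A k = {t \<in> {0..<2 * pi} - T. card {u \<in> T. u < t} = k}" for k
  have "is_interval (A k)" for k
    unfolding is_interval_1
  proof (intro ballI allI impI)
    fix a b x assume a: "a \<in> A k" and b: "b \<in> A k" and x: "a \<le> x \<and> x \<le> b"
    have le: "card {u \<in> T. u < a} \<le> card {u \<in> T. u < x}" "card {u \<in> T. u < x} \<le> card {u \<in> T. u < b}"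
      using T(1) x by (intro card_mono; force)+
    have "x \<notin> T"
    proof
      assume xT: "x \<in> T"
      then have "x \<noteq> b" using b by (auto simp: A_def)
      then have "x \<in> {u \<in> T. u < b} - {u \<in> T. u < a}" using x xT by simp
      moreover have "{u \<in> T. u < a} \<subseteq> {u \<in> T. u < b}" using x by (blast intro: less_le_trans order_trans)
      ultimately have "{u \<in> T. u < a} \<subset> {u \<in> T. u < b}" by blast
      then have "card {u \<in> T. u < a} < card {u \<in> T. u < b}" using T(1) by (intro psubset_card_mono) auto
      then show False using a b by (simp add: A_def)
    qed
    then show "x \<in> A k" using a b x le by (simp add: A_def)
  qed
  then have conn: "connected (circle_path ` A k)" for k
    by (intro connected_continuous_image continuous_circle_path) (simp add: is_interval_connected_1)
  have "card {u \<in> T. u < t} \<in> {..card T}" for t using T(1) by (auto intro: card_mono)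
  then have "{0..<2 * pi} - T = (\<Union>k\<in>{..card T}. A k)" by (auto simp: A_def)
  then have "circle_path ` ({0..<2 * pi} - T) = (\<Union>k\<in>{..card T}. circle_path ` A k)" by (simp add: image_UN)
  moreover have "circle_path ` ({0..<2 * pi} - T) = sphere 0 1 - B"
    unfolding circle_path_image[symmetric] by (auto simp: T_def)
  ultimately have eq: "sphere 0 1 - B = (\<Union>k\<in>{..card T}. circle_path ` A k)" by simp
  show ?thesis
    using components_UN_connected[of "{..card T}" "\<lambda>k. circle_path ` A k"] conn T(2) unfolding eq by simp
qed

section \<open>The integral of the number of corner hits\<close>

text \<open>The set \<open>D_\<sigma>\<close>. The unfolded corner is
  \<open>inv (fold_map \<sigma>) A\<close>, and its distance from \<open>z\<close> is the length of
  the orbit.\<close>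

definition hit_set where
  "hit_set P A \<sigma> l = {z \<in> interior P. itin P \<sigma> z (inv (fold_map \<sigma>) A) \<and> dist z (inv (fold_map \<sigma>) A) \<le> l}"

lemma borel_hit_set: "hit_set P A \<sigma> l \<in> sets borel"
proof -
  have "{z. itin P \<sigma> z (inv (fold_map \<sigma>) A)} \<in> sets borel" by (rule borel_itin) simp
  moreover have "interior P \<inter> cball (inv (fold_map \<sigma>) A) l \<in> sets borel" by simp
  ultimately have "{z. itin P \<sigma> z (inv (fold_map \<sigma>) A)} \<inter> (interior P \<inter> cball (inv (fold_map \<sigma>) A) l) \<in> sets borel"
    by (rule sets.Int)
  also have "{z. itin P \<sigma> z (inv (fold_map \<sigma>) A)} \<inter> (interior P \<inter> cball (inv (fold_map \<sigma>) A) l) = hit_set P A \<sigma> l"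
    by (auto simp: hit_set_def dist_commute)
  finally show ?thesis .
qed

lemma hit_set_lmeasurable: "hit_set P A \<sigma> l \<in> lmeasurable"
proof -
  have "hit_set P A \<sigma> l \<subseteq> cball (inv (fold_map \<sigma>) A) l" by (auto simp: hit_set_def dist_commute)
  then show ?thesis using borel_hit_set[of P A \<sigma> l]
    by (intro bounded_set_imp_lmeasurable) (auto intro: bounded_subset[OF bounded_cball])
qed

lemma emeasure_fold_map_image:
  assumes "unit_normals \<sigma>" "S \<in> lmeasurable"
  shows "fold_map \<sigma> ` S \<in> lmeasurable" "emeasure lebesgue (fold_map \<sigma> ` S) = emeasure lebesgue S"
proof -
  have im: "fold_map \<sigma> ` S = (+) (fold_map \<sigma> 0) ` (fold_dir \<sigma> ` S)"
    unfolding image_image using fold_map_eq[of \<sigma>] by argo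
  note o = orthogonal_fold_dir[OF assms(1)]
  have 1: "fold_dir \<sigma> ` S \<in> lmeasurable" by (rule measurable_orthogonal_image[OF o assms(2)])
  show 2: "fold_map \<sigma> ` S \<in> lmeasurable" unfolding im by (rule measurable_translation[OF 1])
  have "measure lebesgue (fold_map \<sigma> ` S) = measure lebesgue S"
    unfolding im measure_translation by (rule measure_orthogonal_image[OF o assms(2)])
  then show "emeasure lebesgue (fold_map \<sigma> ` S) = emeasure lebesgue S"
    using 2 assms(2) by (simp add: emeasure_eq_measure2)
qed

text \<open>The number of itineraries from \<open>z\<close> to \<open>A\<close>, as an integral over
  counting measure: it may be infinite, and Tonelli's theorem applies.\<close>

definition hit_count :: "(real^2) set \<Rightarrow> real^2 \<Rightarrow> real \<Rightarrow> real^2 \<Rightarrow> ennreal" where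
  "hit_count P A l z = (\<integral>\<^sup>+\<sigma>. indicator (hit_set P A \<sigma> l) z \<partial>count_space (lists (side_lines P)))"

lemma inv_fold_map: "unit_normals \<sigma> \<Longrightarrow> fold_map \<sigma> (inv (fold_map \<sigma>) A) = A"
  by (simp add: bij_fold_map bij_is_surj surj_f_inv_f)

text \<open>By Tonelli the integral is the sum of the areas of the \<open>D_\<sigma>\<close>.
  Folding preserves each area and makes the sets disjoint within one disc of radius \<open>l\<close>
  around \<open>A\<close>.\<close>

lemma hit_count_bound:
  assumes "countable (side_lines P)" "l \<ge> 0"
  shows "(\<integral>\<^sup>+z. hit_count P A l z \<partial>lebesgue) \<le> ennreal (unit_ball_vol 2 * l\<^sup>2)"
    and "hit_count P A l \<in> borel_measurable lebesgue"
proof -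
  let ?L = "lists (side_lines P)" and ?X = "\<lambda>\<sigma>. hit_set P A \<sigma> l"
  have cL: "countable ?L" using assms(1) by (rule countable_lists)
  have X: "?X \<sigma> \<in> sets lebesgue" for \<sigma> using hit_set_lmeasurable by blast
  have ind: "(indicator (?X \<sigma>) :: real^2 \<Rightarrow> ennreal) \<in> borel_measurable lebesgue" for \<sigma>
    using X by simp
  \<comment> \<open>A common image point means that both orbits, unfolded backwards from
    \<open>A\<close>, run along the same segment.\<close>
  have disj: "disjoint_family_on (\<lambda>\<sigma>. fold_map \<sigma> ` ?X \<sigma>) ?L"
    unfolding disjoint_family_on_def
  proof (intro ballI impI)
    fix \<sigma> \<tau> assume L: "\<sigma> \<in> ?L" "\<tau> \<in> ?L" "\<sigma> \<noteq> \<tau>"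
    have "\<sigma> = \<tau>" if "x \<in> ?X \<sigma>" "y \<in> ?X \<tau>" "fold_map \<sigma> x = fold_map \<tau> y" for x y
      using itin_unique[of P \<sigma> x "inv (fold_map \<sigma>) A" \<tau> y "inv (fold_map \<tau>) A"] that
        inv_fold_map[OF unit_normals_side_lines[OF L(1)]] inv_fold_map[OF unit_normals_side_lines[OF L(2)]]
      by (simp add: hit_set_def)
    then show "fold_map \<sigma> ` ?X \<sigma> \<inter> fold_map \<tau> ` ?X \<tau> = {}" using L(3) by blast
  qed
  have sub: "fold_map \<sigma> ` ?X \<sigma> \<subseteq> cball A l" if "\<sigma> \<in> ?L" for \<sigma>
  proof
    fix y assume "y \<in> fold_map \<sigma> ` ?X \<sigma>"
    then obtain x where x: "y = fold_map \<sigma> x" "dist x (inv (fold_map \<sigma>) A) \<le> l" by (auto simp: hit_set_def)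
    then have "dist y A \<le> l"
      using dist_fold_map[OF unit_normals_side_lines[OF that], of x "inv (fold_map \<sigma>) A"]
        inv_fold_map[OF unit_normals_side_lines[OF that]] by simp
    then show "y \<in> cball A l" by (simp add: dist_commute)
  qed
  have im: "fold_map \<sigma> ` ?X \<sigma> \<in> sets lebesgue" if "\<sigma> \<in> ?L" for \<sigma>
    using emeasure_fold_map_image(1)[OF unit_normals_side_lines[OF that] hit_set_lmeasurable] by blast
  have "(\<integral>\<^sup>+z. hit_count P A l z \<partial>lebesgue) = (\<integral>\<^sup>+\<sigma>. \<integral>\<^sup>+z. indicator (?X \<sigma>) z \<partial>lebesgue \<partial>count_space ?L)"
    unfolding hit_count_def by (rule nn_integral_count_space_nn_integral[OF cL ind])
  also have "\<dots> = (\<integral>\<^sup>+\<sigma>. emeasure lebesgue (?X \<sigma>) \<partial>count_space ?L)"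
    using X by simp
  also have "\<dots> = (\<integral>\<^sup>+\<sigma>. emeasure lebesgue (fold_map \<sigma> ` ?X \<sigma>) \<partial>count_space ?L)"
    by (intro nn_integral_cong) (simp add: emeasure_fold_map_image(2)[OF unit_normals_side_lines hit_set_lmeasurable])
  also have "\<dots> = emeasure lebesgue (\<Union>\<sigma>\<in>?L. fold_map \<sigma> ` ?X \<sigma>)"
    by (rule emeasure_UN_countable[OF im cL disj, symmetric])
  also have "\<dots> \<le> emeasure lebesgue (cball A l)"
    using sub by (intro emeasure_mono) auto
  also have "\<dots> = ennreal (unit_ball_vol 2 * l\<^sup>2)"
    using assms(2) by (simp add: emeasure_cball)
  finally show "(\<integral>\<^sup>+z. hit_count P A l z \<partial>lebesgue) \<le> ennreal (unit_ball_vol 2 * l\<^sup>2)" .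
  have "(\<lambda>(\<sigma>, z). indicator (?X \<sigma>) z :: ennreal) \<in> borel_measurable (count_space ?L \<Otimes>\<^sub>M lebesgue)"
    by (rule measurable_pair_measure_countable1[OF cL]) (simp add: ind)
  then have "(\<lambda>(z, \<sigma>). indicator (?X \<sigma>) z :: ennreal) \<in> borel_measurable (lebesgue \<Otimes>\<^sub>M count_space ?L)"
    by (subst measurable_pair_swap_iff) (simp add: case_prod_unfold)
  then show "hit_count P A l \<in> borel_measurable lebesgue"
    unfolding hit_count_def
    by (rule sigma_finite_measure.borel_measurable_nn_integral
        [OF sigma_finite_measure_count_space_countable[OF cL]])
qed

lemma hit_count_eq:
  "hit_count P A l z = emeasure (count_space (lists (side_lines P))) {\<sigma> \<in> lists (side_lines P). z \<in> hit_set P A \<sigma> l}"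
proof -
  have "hit_count P A l z = (\<integral>\<^sup>+\<sigma>. indicator {\<sigma> \<in> lists (side_lines P). z \<in> hit_set P A \<sigma> l} \<sigma> \<partial>count_space (lists (side_lines P)))"
    unfolding hit_count_def by (intro nn_integral_cong) (auto simp: indicator_def)
  also have "\<dots> = emeasure (count_space (lists (side_lines P))) {\<sigma> \<in> lists (side_lines P). z \<in> hit_set P A \<sigma> l}"
    by (rule nn_integral_indicator) auto
  finally show ?thesis .
qed

section \<open>Growth of the number of corner hits\<close>

definition hit_itins where
  "hit_itins P A z l = {\<sigma> \<in> lists (side_lines P). z \<in> hit_set P A \<sigma> l}"

text \<open>The quadratic integral bound, fed into \<open>AE_dyadic_bound\<close> with the exponents
  2 and \<open>2 + \<epsilon>\<close>.\<close>

lemma AE_hit_itins_growth: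
  assumes "finite (side_lines P)" "\<epsilon> > 0"
  shows "AE z in lebesgue. \<exists>K\<ge>0. \<forall>k::nat. finite (hit_itins P A z (2 ^ k)) \<and>
    real (card (hit_itins P A z (2 ^ k))) \<le> K * (2 ^ k) powr (2 + \<epsilon>)"
proof -
  have c: "countable (side_lines P)" using assms(1) by (rule countable_finite)
  have "(\<integral>\<^sup>+z. hit_count P A (2 ^ k) z \<partial>lebesgue) \<le> ennreal (unit_ball_vol 2 * (2 ^ k) powr 2)" for k
    using hit_count_bound(1)[OF c, of "2 ^ k" A] by simp
  then have "AE z in lebesgue. \<exists>K\<ge>0. \<forall>k::nat. hit_count P A (2 ^ k) z \<le> ennreal (K * (2 ^ k) powr (2 + \<epsilon>))"
    using hit_count_bound(2)[OF c] assms(2)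
    by (intro AE_dyadic_bound[where q = 2 and C = "unit_ball_vol 2"]) simp_all
  then show ?thesis
  proof eventually_elim
    case (elim z)
    then obtain K where K: "K \<ge> 0" "\<And>k::nat. hit_count P A (2 ^ k) z \<le> ennreal (K * (2 ^ k) powr (2 + \<epsilon>))" by blast
    have "finite (hit_itins P A z (2 ^ k)) \<and> real (card (hit_itins P A z (2 ^ k))) \<le> K * (2 ^ k) powr (2 + \<epsilon>)" for k :: nat
    proof -
      have sub: "hit_itins P A z (2 ^ k) \<subseteq> lists (side_lines P)" by (auto simp: hit_itins_def)
      have le: "emeasure (count_space (lists (side_lines P))) (hit_itins P A z (2 ^ k)) \<le> ennreal (K * (2 ^ k) powr (2 + \<epsilon>))"
        using K(2)[of k] unfolding hit_count_eq hit_itins_def .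
      \<comment> \<open>Infinite sets have infinite counting measure; finiteness comes first because
        \<open>card\<close> of an infinite set is 0.\<close>
      have fin: "finite (hit_itins P A z (2 ^ k))"
      proof (rule ccontr)
        assume "infinite (hit_itins P A z (2 ^ k))"
        then show False using le emeasure_count_space_infinite[OF sub] by (simp add: top_unique)
      qed
      then have "ennreal (real (card (hit_itins P A z (2 ^ k)))) \<le> ennreal (K * (2 ^ k) powr (2 + \<epsilon>))"
        using le emeasure_count_space_finite[OF sub fin] by (simp add: ennreal_of_nat_eq_real_of_nat)
      then show ?thesis using fin K(1) by (simp add: ennreal_le_iff)
    qed
    then show ?case using K(1) by blast
  qed
qed

lemma hit_itins_mono: "l \<le> m \<Longrightarrow> hit_itins P A z l \<subseteq> hit_itins P A z m"
  by (auto simp: hit_itins_def hit_set_def)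

text \<open>The direction points from \<open>z\<close> to the unfolded corner, so it is a function
  \<open>g\<close> of the corner and the itinerary.\<close>

lemma corner_directions_bound:
  assumes "z \<in> interior P" "finite (corners P)" "\<And>A. A \<in> corners P \<Longrightarrow> finite (hit_itins P A z l)"
  shows "finite {v. norm v = 1 \<and> hits_corner P z v l}"
    and "card {v. norm v = 1 \<and> hits_corner P z v l} \<le> (\<Sum>A\<in>corners P. card (hit_itins P A z l))"
proof -
  let ?B = "{v. norm v = 1 \<and> hits_corner P z v l}"
  define I where "I = (SIGMA A:corners P. hit_itins P A z l)"
  define g where "g = (\<lambda>(A, \<sigma>). (inv (fold_map \<sigma>) A - z) /\<^sub>R dist z (inv (fold_map \<sigma>) A))"
  have sub: "?B \<subseteq> g ` I"
  proof
    fix v assume "v \<in> ?B"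
    then obtain t \<sigma> where v: "norm v = 1" "t > 0" "t \<le> l" "itin P \<sigma> z (z + t *\<^sub>R v)"
      "fold_map \<sigma> (z + t *\<^sub>R v) \<in> corners P"
      unfolding hits_corner_def by blast
    define A where "A = fold_map \<sigma> (z + t *\<^sub>R v)"
    have L: "\<sigma> \<in> lists (side_lines P)" using itin_side_lines[OF v(4)] .
    have inv: "inv (fold_map \<sigma>) A = z + t *\<^sub>R v"
      unfolding A_def using bij_fold_map[OF unit_normals_side_lines[OF L]] by (simp add: bij_is_inj)
    have d: "dist z (z + t *\<^sub>R v) = t" using v(1,2) by (simp add: dist_norm)
    have "(A, \<sigma>) \<in> I"
      using L v assms(1) d inv by (auto simp: I_def hit_itins_def hit_set_def A_def)
    moreover have "g (A, \<sigma>) = v" using v(2) by (simp add: g_def inv d)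
    ultimately show "v \<in> g ` I" by force
  qed
  have fin: "finite I" unfolding I_def using assms(2,3) by (rule finite_SigmaI)
  show "finite ?B" using fin sub by (rule finite_surj)
  have "card ?B \<le> card I" using fin sub by (rule surj_card_le)
  also have "card I = (\<Sum>A\<in>corners P. card (hit_itins P A z l))"
    unfolding I_def using assms(2,3) by simp
  finally show "card ?B \<le> (\<Sum>A\<in>corners P. card (hit_itins P A z l))" .
qed

lemma inward_directions_interior:
  assumes "z \<in> interior P" shows "inward_directions P z = sphere 0 1"
proof -
  obtain d where d: "d > 0" "ball z d \<subseteq> interior P" using assms by (meson open_contains_ball open_interior)
  have "z + r *\<^sub>R v \<in> interior P" if "norm v = 1" "0 < r" "r < d" for v r
    using that d(2) by (auto simp: dist_norm subset_iff)
  then show ?thesis using d(1) by (auto simp: inward_directions_def)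
qed

text \<open>The directions missing from the circle all hit corners, so there are finitely many, and
  removing them leaves at most one component more than their number. The longer time
  \<open>m\<close> will be a power of two.\<close>

lemma position_complexity_bound:
  assumes "z \<in> interior P" "finite (corners P)" "\<And>A. A \<in> corners P \<Longrightarrow> finite (hit_itins P A z m)" "l \<le> m"
  shows "finite (components (regular_directions P z l))"
    and "position_complexity P z l \<le> (\<Sum>A\<in>corners P. card (hit_itins P A z m)) + 1"
proof -
  have fin: "finite (hit_itins P A z l)" if "A \<in> corners P" for A
    using finite_subset[OF hit_itins_mono[OF assms(4)] assms(3)[OF that]] .
  define B where "B = sphere 0 1 - regular_directions P z l"
  let ?H = "{v. norm v = 1 \<and> hits_corner P z v l}"
  note H = corner_directions_bound[OF assms(1,2) fin]
  have sub: "B \<subseteq> ?H"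
  proof
    fix v assume "v \<in> B"
    then obtain t y w where v: "norm v = 1" "0 < t" "t \<le> l" "billiard_flow P z v t y w" "y \<in> corners P"
      unfolding B_def regular_directions_def inward_directions_interior[OF assms(1)] by auto
    then have "v \<noteq> 0" by auto
    from flow_corner_hits_corner[OF v(4) assms(1) this v(2,5)]
    show "v \<in> ?H" using hits_corner_mono v(1,3) by blast
  qed
  have B: "finite B" using sub H(1) by (rule finite_subset)
  have card_B: "card B \<le> (\<Sum>A\<in>corners P. card (hit_itins P A z l))"
    using card_mono[OF H(1) sub] H(2) by (rule order_trans)
  have "regular_directions P z l \<subseteq> sphere 0 1"
    using inward_directions_interior[OF assms(1)] by (auto simp: regular_directions_def)
  then have R: "regular_directions P z l = sphere 0 1 - B" by (auto simp: B_def)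
  show "finite (components (regular_directions P z l))"
    unfolding R using components_circle_minus_finite[OF B] by blast
  have "position_complexity P z l \<le> card B + 1"
    unfolding position_complexity_def R using components_circle_minus_finite[OF B] by blast
  also have "(\<Sum>A\<in>corners P. card (hit_itins P A z l)) \<le> (\<Sum>A\<in>corners P. card (hit_itins P A z m))"
    by (intro sum_mono card_mono assms(3) hit_itins_mono assms(4))
  then have "card B + 1 \<le> (\<Sum>A\<in>corners P. card (hit_itins P A z m)) + 1" using card_B by simp
  finally show "position_complexity P z l \<le> (\<Sum>A\<in>corners P. card (hit_itins P A z m)) + 1" .
qed

lemma dyadic_above:
  fixes l :: real assumes "l \<ge> 1"
  obtains k where "l \<le> 2 ^ k" "2 ^ k \<le> 2 * l"
proof -
  define k where "k = nat \<lceil>log 2 l\<rceil>"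
  have "0 \<le> log 2 l" using assms by simp
  then have k: "log 2 l \<le> real k" "real k \<le> log 2 l + 1" unfolding k_def by linarith+
  have "2 powr log 2 l \<le> 2 powr real k" "2 powr real k \<le> 2 powr (log 2 l + 1)"
    using k by (intro powr_mono; simp)+
  then show thesis using assms by (intro that[of k]) (simp_all add: powr_realpow powr_add)
qed

theorem corollary8:
  fixes P :: "(real^2) set" and \<epsilon> :: real
  assumes "polygon P" and "\<epsilon> > 0"
  shows "AE z in lebesgue. z \<in> P \<longrightarrow>
           (\<forall>l. finite (components (regular_directions P z l))) \<and>
           (\<lambda>l. real (position_complexity P z l)) \<in> O[at_top](\<lambda>l. l powr (2 + \<epsilon>))"
proof -
  obtain S where P: "closed P" "closure (interior P) = P"
    and S: "finite S" "frontier P = (\<Union>(a, b)\<in>S. closed_segment a b)"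
    using assms(1) compact_imp_closed unfolding polygon_def by blast
  have lines: "finite (side_lines P)" using finite_side_lines[OF S] .
  have crn: "finite (corners P)" using finite_corners[OF P S] .
  \<comment> \<open>Almost every point of \<open>P\<close> is interior, and there all directions of
    the circle are admissible.\<close>
  have "negligible (frontier P)"
    unfolding S(2) using S(1) by (intro negligible_Union) (auto simp: negligible_closed_segment)
  then have "AE z in lebesgue. z \<notin> frontier P"
    by (simp add: AE_not_in negligible_iff_null_sets)
  moreover have "AE z in lebesgue. \<forall>A\<in>corners P. \<exists>K\<ge>0. \<forall>k::nat. finite (hit_itins P A z (2 ^ k)) \<and>
    real (card (hit_itins P A z (2 ^ k))) \<le> K * (2 ^ k) powr (2 + \<epsilon>)"
    using crn AE_hit_itins_growth[OF lines assms(2)] by (intro AE_ball_countable' countable_finite) auto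
  ultimately show ?thesis
  proof eventually_elim
    case (elim z)
    obtain K where K: "\<And>A. A \<in> corners P \<Longrightarrow> K A \<ge> 0"
      "\<And>A k. A \<in> corners P \<Longrightarrow> finite (hit_itins P A z (2 ^ k))"
      "\<And>A k. A \<in> corners P \<Longrightarrow> real (card (hit_itins P A z (2 ^ k))) \<le> K A * (2 ^ k) powr (2 + \<epsilon>)"
      using elim(2) by metis
    show ?case
    proof (intro impI conjI allI)
      assume "z \<in> P"
      then have z: "z \<in> interior P" using elim(1) closure_subset by (auto simp: frontier_def)
      show "finite (components (regular_directions P z l))" for l
      proof -
        obtain k where "l \<le> 2 ^ k" using real_arch_pow[of 2 l] less_imp_le by fastforce
        then show ?thesis using position_complexity_bound(1)[OF z crn K(2)] by blast
      qed
      define C where "C = (\<Sum>A\<in>corners P. K A)"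
      have C: "C \<ge> 0" unfolding C_def using K(1) by (rule sum_nonneg)
      \<comment> \<open>A power of two between \<open>l\<close> and \<open>2 * l\<close> costs the
        factor \<open>2 powr (2 + \<epsilon>)\<close>; for \<open>l \<ge> 1\<close> the additional 1
        is at most \<open>l powr (2 + \<epsilon>)\<close>.\<close>
      have "real (position_complexity P z l) \<le> (C * 2 powr (2 + \<epsilon>) + 1) * l powr (2 + \<epsilon>)" if l: "l \<ge> 1" for l
      proof -
        obtain k where k: "l \<le> 2 ^ k" "2 ^ k \<le> 2 * l" using dyadic_above[OF l] .
        have "real (position_complexity P z l) \<le> real ((\<Sum>A\<in>corners P. card (hit_itins P A z (2 ^ k))) + 1)"
          using position_complexity_bound(2)[OF z crn K(2) k(1)] by (simp only: of_nat_le_iff)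
        also have "\<dots> = (\<Sum>A\<in>corners P. real (card (hit_itins P A z (2 ^ k)))) + 1" by simp
        also have "\<dots> \<le> (\<Sum>A\<in>corners P. K A * (2 ^ k) powr (2 + \<epsilon>)) + 1"
          by (intro add_mono sum_mono K(3)) simp_all
        also have "\<dots> = C * (2 ^ k) powr (2 + \<epsilon>) + 1" by (simp add: C_def sum_distrib_right)
        also have "\<dots> \<le> C * (2 * l) powr (2 + \<epsilon>) + l powr (2 + \<epsilon>)"
          using C k l assms(2) by (intro add_mono mult_left_mono powr_mono2) (simp_all add: ge_one_powr_ge_zero)
        also have "\<dots> = (C * 2 powr (2 + \<epsilon>) + 1) * l powr (2 + \<epsilon>)"
          using l by (simp add: powr_mult algebra_simps)
        finally show ?thesis .
      qed
      then have "eventually (\<lambda>l. norm (real (position_complexity P z l)) \<le>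
          (C * 2 powr (2 + \<epsilon>) + 1) * norm (l powr (2 + \<epsilon>))) at_top"
        by (intro eventually_mono[OF eventually_ge_at_top[of 1]]) simp
      then show "(\<lambda>l. real (position_complexity P z l)) \<in> O[at_top](\<lambda>l. l powr (2 + \<epsilon>))"
        by (rule bigoI)
    qed
  qed
qed

end
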